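(* Let $\gamma\ge 1$, suppose $\theta \le c_t^{-1}\operatorname{tr}(A_t)\le \Theta$ for all $t=1,\dots,m$, with $\theta>0$ and $h'(0)>0$, and let $\rho_1\ge\max_t c_t$ and $\rho_2\ge\max_t\lambda_{\max}(A_t)$. Define $G_S$ by $G_S(0)=0$ and $$G_S'(u)=-\frac{\theta\gamma}{(b+\rho_1\gamma)(e-1)}\int_0^u \exp\!\left(\tfrac{\gamma}{b+\rho_1\gamma}(u-v)\right)h'(\theta v)\,dv,\qquad u\ge 0,$$ with $G_S=0$ on the negative reals. Let $\beta(\gamma)$ denote the optimal value of the optimization problem over $(\beta,y,\mu)$: $$\text{minimize } \beta\quad\text{subject to}\quad \begin{cases}\gamma\int_0^u y(s)\,ds+\gamma\rho_2\,(y(0)-y(u))-h^*(y(u))\le \beta\,h(u)\quad \text{for all } u\in[0,u_{\max}],\\[2pt] y(t)=\int_0^1\frac{1}{t\lambda+(1-\lambda)}\,d\mu(\lambda),\\[2pt] \mu \text{ a positive measure supported on } [0,1].\end{cases}$$ Let $y$ be optimal for this problem, let $h_S(u)=\int_0^u y(s)\,ds$ for $u\ge 0$, extended linearly to the negative reals, and let $H_S(U)=\sum_{i=1}^n h_S(\lambda_i(U))$; assume $h_S'(0)=h'(0)$. Let $\hat x_1,\dots,\hat x_m$ be the iterates of the sequential update algorithm run with $H_S$ and $G_S$, and assume $u_{\max}\ge \lambda_{\max}\left(\sum_{t=1}^m A_t\hat x_t\right)$. Then $$\sum_{t=1}^m c_t\hat x_t\ \le\ (G_S')^{-1}\!\left(-h'(0)\Theta\right)+\rho_1\qquad\text{and}\qquad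 H\!\left(\sum_{t=1}^m A_t\hat x_t\right)\ \ge\ \frac{1}{\gamma/(e-1)+\beta(\gamma)}\,D^\star,$$ where $(G_S')^{-1}$ is the inverse function of $G_S':[0,\infty)\to(-\infty,0]$.
   Context: $S^n$ is the space of real symmetric $n\times n$ matrices with $\langle A,B\rangle=\operatorname{tr}(AB)$; $S_+^n$ is the positive semidefinite cone; $\lambda_i(X)$ are the eigenvalues of $X$; $(a)_+=\max(a,0)$; $e=2.718\ldots$ is Euler's number. Problem data: $A_1,\dots,A_m\in S_+^n$, scalars $c_1,\dots,c_m>0$, budget $b>0$. The function $h:[0,\infty)\to\mathbf R$ is concave, monotonically increasing, differentiable (one-sided at $0$), with $h(0)=0$; $H(U)=\sum_{i=1}^n h(\lambda_i(U))$ on $S_+^n$. $G(u)=0$ if $u\in[0,b]$ and $G(u)=-\infty$ otherwise. Concave conjugates: $\psi^*(y)=\inf_u\{\langle y,u\rangle-\psi(u)\}$, the infimum being over the domain of $\psi$. Thus $h^*(y)=\inf_{u\ge0}(yu-h(u))$, $H^*(Y)=\inf_{U\in S_+^n}(\langle Y,U\rangle-H(U))$, and $G^*(z)=bz$ if $z\le0$, $G^*(z)=0$ if $z>0$. The offline problem is: maximize $H(\sum_t A_tx_t)+G(\sum_t c_tx_t)$ over $x_1,\dots,x_m\in[0,1]$. $D^\star$ is the optimal value of its dual: minimize $\sum_{t=1}^m(\langle A_t,Y\rangle+c_tz)_+-H^*(Y)-G^*(z)$ over $Y\in S^n$, $z\in\mathbf R$. Sequential update algorithm (run with surrogate functions $H_S$,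 $G_S$): initialize $\hat z_0=G_S'(0)$, $\hat Y_0=\nabla H_S(0)$. For $t=1,\dots,m$: receive $A_t,c_t$; set $\hat x_t=1$ if $c_t\hat z_{t-1}+\langle A_t,\hat Y_{t-1}\rangle>0$ and $\hat x_t=0$ otherwise; set $\hat Y_t=\nabla H_S(\sum_{s=1}^tA_s\hat x_s)$ and $\hat z_t=G_S'(\sum_{s=1}^tc_s\hat x_s)$. *)

theory Defs
  imports "HOL-Analysis.Analysis" "HOL-Computational_Algebra.Polynomial"
begin

section \<open>Symmetric matrices and spectral functions\<close>

definition sym_mats :: "(real^'n^'n) set" where
  "sym_mats = {A. transpose A = A}"

definition psd_mats :: "(real^'n^'n) set" where
  "psd_mats = {A \<in> sym_mats. \<forall>v. 0 \<le> v \<bullet> (A *v v)}"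

definition mat_inner :: "real^'n^'n \<Rightarrow> real^'n^'n \<Rightarrow> real" where
  "mat_inner A B = trace (A ** B)"

definition charpoly :: "real^'n^'n \<Rightarrow> real poly" where
  "charpoly A = det (\<chi> i j. (if i = j then [:0, 1:] else 0) - [:A $ i $ j:])"

text \<open>The multiset of real roots of the characteristic polynomial. It is only used for symmetric
  matrices, where it has \<open>CARD('n)\<close> elements, the eigenvalues with multiplicity.\<close>

definition eigvals :: "real^'n^'n \<Rightarrow> real multiset" where
  "eigvals A = proots (charpoly A)"

definition lambda_max :: "real^'n^'n \<Rightarrow> real" where
  "lambda_max A = Max (set_mset (eigvals A))"

definition spectral_sum :: "(real \<Rightarrow> real) \<Rightarrow> real^'n^'n \<Rightarrow> real" where
  "spectral_sum f A = (\<Sum>l\<in>#eigvals A. f l)"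

text \<open>The gradient with respect to the trace inner product in the Euclidean space of symmetric
  matrices, hence the derivative is taken within \<open>sym_mats\<close> and the gradient is symmetric. The
  norm of the type \<open>real^'n^'n\<close> is the Frobenius norm, i.e. the one induced by \<open>mat_inner\<close> on
  \<open>sym_mats\<close>.\<close>

definition sym_gradient :: "(real^'n^'n \<Rightarrow> real) \<Rightarrow> real^'n^'n \<Rightarrow> real^'n^'n" where
  "sym_gradient F U =
     (THE Y. Y \<in> sym_mats \<and> (F has_derivative (\<lambda>V. mat_inner Y V)) (at U within sym_mats))"


section \<open>Concave conjugates and the dual problem\<close>

text \<open>\<open>p\<close> is the duality pairing and \<open>D\<close> the domain of \<open>\<psi>\<close>. The value may be \<open>-\<infinity>\<close>.\<close>

definition concave_conj :: "('a \<Rightarrow> 'a \<Rightarrow> real) \<Rightarrow> 'a set \<Rightarrow> ('a \<Rightarrow> real) \<Rightarrow> 'a \<Rightarrow> ereal" where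
  "concave_conj p D \<psi> y = (INF u\<in>D. ereal (p y u - \<psi> u))"

definition h_conj :: "(real \<Rightarrow> real) \<Rightarrow> real \<Rightarrow> ereal" where
  "h_conj h = concave_conj (*) {0..} h"

definition H_conj :: "(real \<Rightarrow> real) \<Rightarrow> real^'n^'n \<Rightarrow> ereal" where
  "H_conj h = concave_conj mat_inner psd_mats (spectral_sum h)"

text \<open>The budget function is \<open>0\<close> on its domain \<open>{0..b}\<close>.\<close>

definition G_conj :: "real \<Rightarrow> real \<Rightarrow> ereal" where
  "G_conj b = concave_conj (*) {0..b} (\<lambda>_. 0)"

lemma G_conj_eq:
  assumes "b > 0"
  shows "G_conj b z = ereal (if z \<le> 0 then b * z else 0)"
proof (cases "z \<le> 0")
  case True
  have "G_conj b z = ereal (z * b)"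
    unfolding G_conj_def concave_conj_def using assms True
    by (intro antisym INF_lower2[of b] INF_greatest) (auto intro: mult_left_mono_neg)
  then show ?thesis using True by (simp add: mult.commute)
next
  case False
  have "G_conj b z = ereal 0"
    unfolding G_conj_def concave_conj_def using assms False
    by (intro antisym INF_lower2[of 0] INF_greatest) auto
  then show ?thesis using False by simp
qed

definition dual_value ::
  "nat \<Rightarrow> (nat \<Rightarrow> real^'n^'n) \<Rightarrow> (nat \<Rightarrow> real) \<Rightarrow> real \<Rightarrow> (real \<Rightarrow> real) \<Rightarrow> ereal" where
  "dual_value m A c b h =
     (INF (Y, z) \<in> sym_mats \<times> UNIV.
        ereal (\<Sum>t=1..m. max 0 (mat_inner (A t) Y + c t * z)) - H_conj h Y - G_conj b z)"


section \<open>Sequential update algorithm\<close>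

definition sequential_update ::
  "nat \<Rightarrow> (nat \<Rightarrow> real^'n^'n) \<Rightarrow> (nat \<Rightarrow> real) \<Rightarrow> (real^'n^'n \<Rightarrow> real) \<Rightarrow> (real \<Rightarrow> real) \<Rightarrow>
    (nat \<Rightarrow> real) \<Rightarrow> (nat \<Rightarrow> real^'n^'n) \<Rightarrow> (nat \<Rightarrow> real) \<Rightarrow> bool" where
  "sequential_update m A c HS GS x Y z \<longleftrightarrow>
     z 0 = deriv GS 0 \<and> Y 0 = sym_gradient HS 0 \<and>
     (\<forall>t\<in>{1..m}.
        x t = (if c t * z (t - 1) + mat_inner (A t) (Y (t - 1)) > 0 then 1 else 0) \<and>
        Y t = sym_gradient HS (\<Sum>s=1..t. x s *\<^sub>R A s) \<and>
        z t = deriv GS (\<Sum>s=1..t. c s * x s))"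


section \<open>Surrogate functions\<close>

definition GS_slope ::
  "real \<Rightarrow> real \<Rightarrow> real \<Rightarrow> real \<Rightarrow> (real \<Rightarrow> real) \<Rightarrow> real \<Rightarrow> real" where
  "GS_slope b \<theta> \<gamma> \<rho>1 h' u =
     - (\<theta> * \<gamma> / ((b + \<rho>1 * \<gamma>) * (exp 1 - 1))) *
       integral {0..u} (\<lambda>v. exp (\<gamma> / (b + \<rho>1 * \<gamma>) * (u - v)) * h' (\<theta> * v))"

definition GS ::
  "real \<Rightarrow> real \<Rightarrow> real \<Rightarrow> real \<Rightarrow> (real \<Rightarrow> real) \<Rightarrow> real \<Rightarrow> real" where
  "GS b \<theta> \<gamma> \<rho>1 h' u = (if u < 0 then 0 else integral {0..u} (GS_slope b \<theta> \<gamma> \<rho>1 h'))"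

text \<open>The linear extension to the negative reals continues the one-sided slope \<open>y 0\<close> at \<open>0\<close>.\<close>

definition hS :: "(real \<Rightarrow> real) \<Rightarrow> real \<Rightarrow> real" where
  "hS y u = (if u < 0 then y 0 * u else integral {0..u} y)"

text \<open>The integral representation of \<open>y\<close> is stated in \<open>ennreal\<close>, where \<open>inverse 0 = \<infinity>\<close>; in
  particular a finite value \<open>y 0\<close> rules out an atom of \<open>\<mu>\<close> at \<open>1\<close>. In the constraint,
  \<open>h_conj h (y u)\<close> may be \<open>-\<infinity>\<close>, in which case the constraint is violated.\<close>

definition surrogate_feasible ::
  "(real \<Rightarrow> real) \<Rightarrow> real \<Rightarrow> real \<Rightarrow> real \<Rightarrow> real \<Rightarrow> (real \<Rightarrow> real) \<Rightarrow> real measure \<Rightarrow> bool" where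
  "surrogate_feasible h \<gamma> \<rho>2 umax \<beta> y \<mu> \<longleftrightarrow>
     (\<forall>u\<in>{0..umax}.
        ereal (\<gamma> * integral {0..u} y + \<gamma> * \<rho>2 * (y 0 - y u)) - h_conj h (y u) \<le> ereal (\<beta> * h u)) \<and>
     (\<forall>t\<ge>0. 0 \<le> y t \<and>
        ennreal (y t) = (\<integral>\<^sup>+l\<in>{0..1}. inverse (ennreal (t * l + (1 - l))) \<partial>\<mu>)) \<and>
     sets \<mu> = sets borel \<and> emeasure \<mu> (- {0..1}) = 0"

definition surrogate_value :: "(real \<Rightarrow> real) \<Rightarrow> real \<Rightarrow> real \<Rightarrow> real \<Rightarrow> ereal" where
  "surrogate_value h \<gamma> \<rho>2 umax =
     Inf {ereal \<beta> | \<beta>. \<exists>y \<mu>. surrogate_feasible h \<gamma> \<rho>2 umax \<beta> y \<mu>}"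

definition surrogate_optimal :: "(real \<Rightarrow> real) \<Rightarrow> real \<Rightarrow> real \<Rightarrow> real \<Rightarrow> (real \<Rightarrow> real) \<Rightarrow> bool" where
  "surrogate_optimal h \<gamma> \<rho>2 umax y \<longleftrightarrow>
     (\<exists>\<beta> \<mu>. surrogate_feasible h \<gamma> \<rho>2 umax \<beta> y \<mu> \<and> ereal \<beta> = surrogate_value h \<gamma> \<rho>2 umax)"

end

(*
  Antitonicity of Y_t and z_t makes every term (<A_t, Y_m> + c_t z_m)_+ of the dual objective at
  (Y_m, z_m) at most x_t (<A_t, Y_{t-1}> + c_t z_{t-1}). Concavity of H_S and G_S telescopes the sum
  of these bounds up to the errors rho2 tr(Y_0 - Y_m) and -rho1 z_m; being nonnegative, the sum may
  also be multiplied by gamma >= 1. On the eigenvalues of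
  sum_t x_t A_t the constraint defining beta(gamma) bounds the matrix part by beta H, and the linear
  differential equation solved by G_S' bounds the scalar part by gamma/(e-1) H. The budget bound
  holds because x_t = 1 forces z_{t-1} > -h'(0) Theta.
*)
theory Submission
  imports Defs
begin

section \<open>Eigenbases and spectral sums\<close>

text \<open>The delicate point is the antitonicity of \<open>Y\<close>: for noncommuting matrices a
  decreasing \<open>y\<close> does not suffice. The representing measure makes \<open>y\<close> a
  positive mixture of the maps t -> 1/(t s + (1 - s)), and these reverse the Loewner order because
  matrix inversion does. The other matrix facts reduce to scalar ones: for eigenbases u of U and v
  of V, the first-order remainder of a spectral sum is the sum of the scalar remainders at the pairs
  (l i, k j) with weights (v j . u i)^2. This one identity gives both the tangent inequality and the
  existence of the gradient, without perturbation theory of eigenvectors. The constant e - 1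
  normalizes the slope of \<open>GS\<close>: with k = gamma / (b + rho1 gamma) and constant h', that
  slope is -theta h'(0) (exp(k u) - 1) / (e - 1), which reaches -theta h'(0) exactly at k u = 1. The
  final division needs a real positive denominator. An attained real optimum excludes umax <= 0, and
  the constraint at umax then yields beta >= 0.\<close>

lemma linear_quadratic_nonneg_imp_zero:
  fixes a b :: real
  assumes "\<And>t. 0 \<le> 2 * t * a + t\<^sup>2 * b" and "b \<ge> 0"
  shows "a = 0"
proof (rule ccontr)
  assume "a \<noteq> 0"
  \<comment> \<open>The point -a/(b + 1), in place of the minimizer -a/b, covers b = 0 as
    well.\<close>
  have "2 * (- a / (b + 1)) * a + (- a / (b + 1))\<^sup>2 * b = - (a\<^sup>2 * (b + 2)) / (b + 1)\<^sup>2"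
    using assms(2) by (simp add: divide_simps power2_eq_square) (simp add: algebra_simps)
  moreover have "a\<^sup>2 * (b + 2) / (b + 1)\<^sup>2 > 0" using assms(2) \<open>a \<noteq> 0\<close> by simp
  ultimately show False using assms(1)[of "- a / (b + 1)"] by simp
qed

text \<open>Take a maximizer x of the Rayleigh quotient on the unit sphere of S, with value l. Then
  l I - f has a nonnegative quadratic form on S that vanishes at x, and varying x in the direction
  (l I - f) x forces that vector to be 0.\<close>

lemma self_adjoint_eigenvector:
  fixes f :: "'a::euclidean_space \<Rightarrow> 'a"
  assumes lin: "linear f" and S: "subspace S" "S \<noteq> {0}" and inv: "f ` S \<subseteq> S"
    and adj: "\<And>x y. x \<in> S \<Longrightarrow> y \<in> S \<Longrightarrow> x \<bullet> f y = f x \<bullet> y"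
  obtains x l where "x \<in> S" "norm x = 1" "f x = l *\<^sub>R x"
proof -
  obtain w where w: "w \<in> S" "w \<noteq> 0" using S subspace_0 by blast
  have cpt: "compact (S \<inter> sphere 0 1)"
    using S(1) by (intro closed_Int_compact closed_subspace compact_sphere)
  have "(1 / norm w) *\<^sub>R w \<in> S \<inter> sphere 0 1" using w S(1) by (auto simp: subspace_scale)
  then have ne: "S \<inter> sphere 0 1 \<noteq> {}" by blast
  have "continuous_on (S \<inter> sphere 0 1) (\<lambda>x. x \<bullet> f x)"
    using lin by (intro continuous_intros linear_continuous_on_compose[of _ "\<lambda>x. x" f]) auto
  from continuous_attains_sup[OF cpt ne this]
  obtain x where x: "x \<in> S" "norm x = 1"
    and mx: "\<And>y. y \<in> S \<Longrightarrow> norm y = 1 \<Longrightarrow> y \<bullet> f y \<le> x \<bullet> f x" by auto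
  define l where "l = x \<bullet> f x"
  define g where "g y = l *\<^sub>R y - f y" for y
  have ling: "linear g" unfolding g_def using lin
    by (auto intro!: linear_compose_sub linear_compose_scale_right linear_ident)
  have gS: "g y \<in> S" if "y \<in> S" for y
    unfolding g_def using that inv S(1) by (auto intro!: subspace_diff subspace_scale)
  have adjg: "y \<bullet> g z = g y \<bullet> z" if "y \<in> S" "z \<in> S" for y z
    using adj[OF that] by (simp add: g_def inner_diff)
  have pos: "0 \<le> y \<bullet> g y" if "y \<in> S" for y
  proof (cases "y = 0")
    case False
    have "((1 / norm y) *\<^sub>R y) \<bullet> f ((1 / norm y) *\<^sub>R y) \<le> l"
      unfolding l_def using False that S(1) by (intro mx) (auto simp: subspace_scale)
    then have "(y \<bullet> f y) / (norm y)\<^sup>2 \<le> l"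
      by (simp add: linear_cmul[OF lin] power2_eq_square)
    then show ?thesis using False
      by (simp add: g_def inner_diff divide_simps power2_norm_eq_inner split: if_splits)
  qed auto
  have x0: "x \<bullet> g x = 0" using x(2) by (simp add: g_def inner_diff l_def norm_eq_1)
  have "g x \<bullet> g x = 0"
  proof (rule linear_quadratic_nonneg_imp_zero[of _ "g x \<bullet> g (g x)"])
    fix t :: real
    have "0 \<le> (x + t *\<^sub>R g x) \<bullet> g (x + t *\<^sub>R g x)"
      using x gS S(1) by (intro pos) (auto intro!: subspace_add subspace_scale)
    also have "\<dots> = 2 * t * (g x \<bullet> g x) + t\<^sup>2 * (g x \<bullet> g (g x))"
      using adjg[OF x(1) gS[OF x(1)]] x0
      by (simp add: linear_add[OF ling] linear_cmul[OF ling] inner_add_left inner_add_right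
          power2_eq_square algebra_simps)
    finally show "0 \<le> 2 * t * (g x \<bullet> g x) + t\<^sup>2 * (g x \<bullet> g (g x))" .
  qed (use pos gS x in auto)
  then have "f x = l *\<^sub>R x" by (simp add: g_def)
  with x that show ?thesis by blast
qed

text \<open>General invariant subspaces let the induction split off an eigenvector: by
  self-adjointness its orthogonal complement in S is again invariant, and its dimension is
  smaller.\<close>

lemma self_adjoint_eigenbasis:
  fixes f :: "'a::euclidean_space \<Rightarrow> 'a"
  assumes lin: "linear f" and S: "subspace S" and inv: "f ` S \<subseteq> S"
    and adj: "\<And>x y. x \<in> S \<Longrightarrow> y \<in> S \<Longrightarrow> x \<bullet> f y = f x \<bullet> y"
  shows "\<exists>B. B \<subseteq> S \<and> pairwise orthogonal B \<and> (\<forall>x\<in>B. norm x = 1 \<and> (\<exists>l. f x = l *\<^sub>R x)) \<and> span B = S"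
  using S inv adj
proof (induction "dim S" arbitrary: S rule: less_induct)
  case less
  show ?case
  proof (cases "S = {0}")
    case True
    then show ?thesis by (intro exI[of _ "{}"]) auto
  next
    case False
    obtain x l where x: "x \<in> S" "norm x = 1" "f x = l *\<^sub>R x"
      using self_adjoint_eigenvector[OF lin less.prems(1) False less.prems(2,3)] by blast
    define T where "T = {y \<in> S. x \<bullet> y = 0}"
    have T: "subspace T" using less.prems(1)
      by (auto simp: T_def subspace_def inner_add_right)
    have TS: "T \<subseteq> S" and "x \<notin> T" using x by (auto simp: T_def)
    then have "dim T < dim S"
      using x T less.prems(1) by (metis dim_subset le_neq_implies_less subspace_dim_equal le_refl)
    moreover have "f ` T \<subseteq> T"
      using less.prems(2,3) x by (force simp: T_def)
    ultimately obtain B where B: "B \<subseteq> T" "pairwise orthogonal B"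
      "\<forall>x\<in>B. norm x = 1 \<and> (\<exists>l. f x = l *\<^sub>R x)" "span B = T"
      using less.hyps[OF _ T] less.prems(3) TS by blast
    have "S \<subseteq> span (insert x B)"
    proof
      fix y assume "y \<in> S"
      then have "y - (x \<bullet> y) *\<^sub>R x \<in> T"
        using x less.prems(1)
        by (auto simp: T_def inner_diff norm_eq_1 intro!: subspace_diff subspace_scale)
      then have "y - (x \<bullet> y) *\<^sub>R x \<in> span B" using B by simp
      then show "y \<in> span (insert x B)" by (auto simp: span_insert)
    qed
    moreover have "span (insert x B) \<subseteq> S"
      using B TS x less.prems(1) by (intro span_minimal) auto
    moreover have "pairwise orthogonal (insert x B)"
      using B by (auto simp: pairwise_insert orthogonal_def T_def inner_commute)
    ultimately show ?thesis using B TS x by (intro exI[of _ "insert x B"]) auto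
  qed
qed

section \<open>Eigenbases of symmetric matrices\<close>

text \<open>Indexing by the coordinate type itself makes every such family a basis, since it has as
  many members as the dimension.\<close>

definition orthonormal :: "('n \<Rightarrow> real^'n) \<Rightarrow> bool" where
  "orthonormal u \<longleftrightarrow> (\<forall>i j. u i \<bullet> u j = (if i = j then 1 else 0))"

definition eigen_system :: "real^'n^'n \<Rightarrow> ('n \<Rightarrow> real) \<Rightarrow> ('n \<Rightarrow> real^'n) \<Rightarrow> bool" where
  "eigen_system A l u \<longleftrightarrow> orthonormal u \<and> (\<forall>i. A *v u i = l i *\<^sub>R u i)"

lemma inner_sym_mats:
  assumes "A \<in> sym_mats"
  shows "v \<bullet> (A *v w) = (A *v v) \<bullet> w"
  using assms by (metis (mono_tags) dot_lmul_matrix mem_Collect_eq sym_mats_def transpose_matrix_vector)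

lemma eigen_system_exists:
  fixes A :: "real^'n^'n"
  assumes "A \<in> sym_mats"
  obtains l u where "eigen_system A l u"
proof -
  obtain B where B: "pairwise orthogonal B" "\<forall>x\<in>B. norm x = 1 \<and> (\<exists>l. A *v x = l *\<^sub>R x)"
    "span B = UNIV"
    using self_adjoint_eigenbasis[of "(*v) A" UNIV] inner_sym_mats[OF assms] by auto
  then have "independent B" by (intro pairwise_orthogonal_independent) auto
  then have "card B = CARD('n)" "finite B"
    using B(3) by (metis dim_span_eq_card_independent dim_UNIV DIM_cart DIM_real mult.right_neutral,
      simp add: independent_imp_finite)
  then obtain u where u: "bij_betw u (UNIV :: 'n set) B"
    by (metis finite_same_card_bij finite)
  then have uB: "u i \<in> B" for i by (auto simp: bij_betw_def)
  have "orthonormal u"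
    unfolding orthonormal_def
  proof (intro allI)
    fix i j
    show "u i \<bullet> u j = (if i = j then 1 else 0)"
    proof (cases "i = j")
      case True
      then show ?thesis using B(2) uB by (auto simp: norm_eq_1)
    next
      case False
      then have "u i \<noteq> u j" using u by (auto simp: bij_betw_def inj_eq)
      then show ?thesis using False B(1) uB by (auto simp: pairwise_def orthogonal_def)
    qed
  qed
  moreover have "\<forall>i. \<exists>l. A *v u i = l *\<^sub>R u i" using B(2) uB by blast
  ultimately show ?thesis using that unfolding eigen_system_def by metis
qed

text \<open>Orthonormality says P P^T = I for the matrix P with rows \<open>u i\<close>. For a
  square matrix this gives P^T P = I, which is completeness.\<close>

lemma orthonormal_parseval:
  fixes u :: "'n::finite \<Rightarrow> real^'n"
  assumes "orthonormal u"
  shows "(\<Sum>i\<in>UNIV. (u i \<bullet> v) * (u i \<bullet> w)) = v \<bullet> w"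
proof -
  define P :: "real^'n^'n" where "P = (\<chi> i. u i)"
  have "P ** transpose P = mat 1"
    using assms by (simp add: vec_eq_iff matrix_matrix_mult_def transpose_def mat_def P_def
        orthonormal_def inner_vec_def)
  then have 1: "transpose P ** P = mat 1" by (simp add: matrix_left_right_inverse)
  have "(\<Sum>i\<in>UNIV. (u i \<bullet> v) * (u i \<bullet> w)) = (P *v v) \<bullet> (P *v w)"
    by (simp add: P_def inner_vec_def[of "_ *v _"] matrix_vector_mult_def)
      (simp add: inner_vec_def)
  also have "\<dots> = v \<bullet> ((transpose P ** P) *v w)"
    by (metis dot_lmul_matrix matrix_vector_mul_assoc transpose_matrix_vector transpose_transpose)
  finally show ?thesis using 1 by simp
qed

lemma orthonormal_expand:
  fixes u :: "'n::finite \<Rightarrow> real^'n"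
  assumes "orthonormal u"
  shows "(\<Sum>i\<in>UNIV. (u i \<bullet> v) *\<^sub>R u i) = v"
proof (rule vector_eq_ldot[THEN iffD1, rule_format])
  fix w
  show "w \<bullet> (\<Sum>i\<in>UNIV. (u i \<bullet> v) *\<^sub>R u i) = w \<bullet> v"
    using orthonormal_parseval[OF assms, of w v]
    by (simp add: inner_sum_right inner_commute mult.commute)
qed

lemma sum_sqr_inner_orthonormal:
  fixes u :: "'n::finite \<Rightarrow> real^'n"
  assumes "orthonormal u" "orthonormal v"
  shows "(\<Sum>i\<in>UNIV. (u i \<bullet> v j)\<^sup>2) = 1"
  using orthonormal_parseval[OF assms(1), of "v j" "v j"] assms(2)
  by (simp add: orthonormal_def power2_eq_square)

lemma eigen_system_apply:
  fixes A :: "real^'n^'n"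
  assumes "eigen_system A l u"
  shows "A *v v = (\<Sum>i\<in>UNIV. (l i * (u i \<bullet> v)) *\<^sub>R u i)"
proof -
  have "A *v v = A *v (\<Sum>i\<in>UNIV. (u i \<bullet> v) *\<^sub>R u i)"
    using assms by (simp add: orthonormal_expand eigen_system_def)
  also have "\<dots> = (\<Sum>i\<in>UNIV. (u i \<bullet> v) *\<^sub>R (A *v u i))"
    by (simp add: linear_sum[OF matrix_vector_mul_linear] matrix_vector_mult_scaleR)
  finally show ?thesis using assms by (simp add: eigen_system_def mult.commute)
qed

lemma eigen_system_quadratic:
  fixes A :: "real^'n^'n"
  assumes "eigen_system A l u"
  shows "v \<bullet> (A *v v) = (\<Sum>i\<in>UNIV. l i * (u i \<bullet> v)\<^sup>2)"
  by (simp add: eigen_system_apply[OF assms] inner_sum_right power2_eq_square inner_commute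
      mult.assoc)

lemma eigen_system_psd_mats:
  assumes "eigen_system A l u" "A \<in> psd_mats"
  shows "0 \<le> l i"
proof -
  have "0 \<le> u i \<bullet> (A *v u i)" using assms(2) by (simp add: psd_mats_def)
  then show ?thesis using assms(1) by (simp add: eigen_system_def orthonormal_def)
qed

lemma proots_prod_linear:
  fixes l :: "'b \<Rightarrow> real"
  assumes "finite I"
  shows "proots (\<Prod>i\<in>I. [:- l i, 1:]) = image_mset l (mset_set I)"
  using assms by induction (simp_all add: proots_mult del: mult_pCons_left mult_pCons_right)

text \<open>Orthonormal eigenvectors as the rows of P give P (X I - A) = (X I - diag l) P over real
  polynomials, P having constant entries. Determinants live in an integral domain, so det P, which
  divides 1, can be cancelled.\<close>

lemma eigvals_eigen_system:
  fixes A :: "real^'n^'n"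
  assumes sym: "A \<in> sym_mats" and "eigen_system A l u"
  shows "eigvals A = image_mset l (mset_set UNIV)"
proof -
  note assms = assms(2)
  define P :: "real poly^'n^'n" where "P = (\<chi> i j. [:u i $ j:])"
  define XA :: "real poly^'n^'n" where "XA = (\<chi> i j. (if i = j then [:0, 1:] else 0) - [:A $ i $ j:])"
  define XD :: "real poly^'n^'n" where "XD = (\<chi> i j. if i = j then [:- l i, 1:] else 0)"
  have pc: "(\<Sum>k\<in>UNIV. [:f k:]) = [:\<Sum>k\<in>UNIV. f k:]" for f :: "'n \<Rightarrow> real"
    by (induction rule: infinite_finite_induct) auto
  have "P ** transpose P = mat 1"
    using assms by (simp add: vec_eq_iff matrix_matrix_mult_def transpose_def mat_def P_def
        eigen_system_def orthonormal_def inner_vec_def pc mult.commute one_pCons)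
  then have "det P * det (transpose P) = 1" by (metis det_I det_mul)
  then have dP: "det P \<noteq> 0" by auto
  have "(P ** XA) $ i $ j = (XD ** P) $ i $ j" for i j
  proof -
    have "(\<Sum>k\<in>UNIV. u i $ k * A $ k $ j) = (A *v u i) $ j"
      using sym by (simp add: matrix_vector_mult_def sym_mats_def transpose_def vec_eq_iff mult.commute)
    also have "\<dots> = l i * u i $ j" using assms by (simp add: eigen_system_def)
    finally have tr: "(\<Sum>k\<in>UNIV. u i $ k * A $ k $ j) = l i * u i $ j" .
    have "(P ** XA) $ i $ j = (\<Sum>k\<in>UNIV. (if k = j then [:0, u i $ k:] else 0) - [:u i $ k * A $ k $ j:])"
      unfolding matrix_matrix_mult_def P_def XA_def
      by (auto simp: algebra_simps intro!: sum.cong)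
    also have "\<dots> = [:0, u i $ j:] - [:l i * u i $ j:]"
      by (simp add: sum_subtractf pc tr)
    also have "\<dots> = (\<Sum>k\<in>UNIV. if k = i then [:- l i, 1:] * [:u k $ j:] else 0)"
      by simp
    also have "\<dots> = (XD ** P) $ i $ j"
      unfolding matrix_matrix_mult_def P_def XD_def vec_lambda_beta by (rule sum.cong) auto
    finally show ?thesis .
  qed
  then have "P ** XA = XD ** P" by (simp add: vec_eq_iff)
  then have "det P * det XA = det P * det XD" by (metis det_mul mult.commute)
  then have "charpoly A = det XD" using dP by (simp add: charpoly_def XA_def)
  also have "\<dots> = (\<Prod>i\<in>UNIV. [:- l i, 1:])"
    by (subst det_diagonal) (auto simp: XD_def)
  finally show ?thesis unfolding eigvals_def by (simp add: proots_prod_linear)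
qed

lemma spectral_sum_eigen_system:
  fixes A :: "real^'n^'n"
  assumes "A \<in> sym_mats" "eigen_system A l u"
  shows "spectral_sum f A = (\<Sum>i\<in>UNIV. f (l i))"
  by (simp add: spectral_sum_def eigvals_eigen_system[OF assms] sum_unfold_sum_mset multiset.map_comp o_def)

lemma eigen_system_le_lambda_max:
  fixes A :: "real^'n^'n"
  assumes "A \<in> sym_mats" "eigen_system A l u"
  shows "l i \<le> lambda_max A"
  by (simp add: lambda_max_def eigvals_eigen_system[OF assms])

lemma quadratic_le_lambda_max:
  fixes A :: "real^'n^'n"
  assumes "A \<in> sym_mats"
  shows "v \<bullet> (A *v v) \<le> lambda_max A * (v \<bullet> v)"
proof -
  obtain l u where e: "eigen_system A l u" using eigen_system_exists[OF assms] .
  have "v \<bullet> (A *v v) \<le> (\<Sum>i\<in>UNIV. lambda_max A * (u i \<bullet> v)\<^sup>2)"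
    unfolding eigen_system_quadratic[OF e]
    by (intro sum_mono mult_right_mono eigen_system_le_lambda_max[OF assms e]) auto
  also have "\<dots> = lambda_max A * (v \<bullet> v)"
    using orthonormal_parseval[of u v v] e
    by (simp add: eigen_system_def power2_eq_square sum_distrib_left[symmetric])
  finally show ?thesis .
qed

section \<open>Functional calculus and the trace inner product\<close>

text \<open>The functional calculus g(A) as the sum of g(l i) u_i u_i^T. It takes the eigendata
  rather than A, so independence of the chosen eigenbasis need not be established first.\<close>

definition spectral_mat :: "(real \<Rightarrow> real) \<Rightarrow> ('n \<Rightarrow> real) \<Rightarrow> ('n::finite \<Rightarrow> real^'n) \<Rightarrow> real^'n^'n" where
  "spectral_mat g l u = (\<chi> a b. \<Sum>i\<in>UNIV. g (l i) * u i $ a * u i $ b)"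

lemma spectral_mat_apply:
  "spectral_mat g l u *v v = (\<Sum>i\<in>UNIV. (g (l i) * (u i \<bullet> v)) *\<^sub>R u i)"
proof -
  have "(\<Sum>b\<in>UNIV. (\<Sum>i\<in>UNIV. g (l i) * u i $ a * u i $ b) * v $ b) =
      (\<Sum>i\<in>UNIV. g (l i) * (\<Sum>b\<in>UNIV. u i $ b * v $ b) * u i $ a)" for a
    unfolding sum_distrib_left sum_distrib_right
    by (subst sum.swap) (simp add: mult_ac)
  then show ?thesis
    by (simp add: vec_eq_iff matrix_vector_mult_def spectral_mat_def inner_vec_def)
qed

lemma spectral_mat_sym: "spectral_mat g l u \<in> sym_mats"
  by (simp add: spectral_mat_def sym_mats_def transpose_def vec_eq_iff mult_ac)

lemma spectral_mat_eigen_system: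
  assumes "orthonormal u"
  shows "eigen_system (spectral_mat g l u) (\<lambda>i. g (l i)) u"
proof -
  have "spectral_mat g l u *v u i = (\<Sum>j\<in>UNIV. if j = i then g (l j) *\<^sub>R u j else 0)" for i
    using assms unfolding spectral_mat_apply by (intro sum.cong) (auto simp: orthonormal_def)
  then show ?thesis using assms by (simp add: eigen_system_def)
qed

lemma eigen_system_spectral_mat:
  assumes "eigen_system A l u"
  shows "spectral_mat (\<lambda>x. x) l u = A"
  by (simp add: matrix_eq spectral_mat_apply eigen_system_apply[OF assms])

lemma mat_inner_alt: "mat_inner A B = (\<Sum>a\<in>UNIV. \<Sum>b\<in>UNIV. A $ a $ b * B $ b $ a)"
  by (simp add: mat_inner_def trace_def matrix_matrix_mult_def)

lemma mat_inner_commute: "mat_inner A B = mat_inner B A"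
  unfolding mat_inner_def by (rule trace_mul_sym)

lemma mat_inner_eq_inner:
  assumes "B \<in> sym_mats"
  shows "mat_inner A B = A \<bullet> B"
  using assms unfolding mat_inner_alt
  by (simp add: inner_vec_def sym_mats_def transpose_def vec_eq_iff)

lemma mat_inner_spectral_mat:
  "mat_inner (spectral_mat g l u) B = (\<Sum>i\<in>UNIV. g (l i) * (u i \<bullet> (B *v u i)))"
proof -
  have "mat_inner (spectral_mat g l u) B =
      (\<Sum>a\<in>UNIV. \<Sum>b\<in>UNIV. \<Sum>i\<in>UNIV. g (l i) * (u i $ b * (B $ b $ a * u i $ a)))"
    unfolding mat_inner_alt spectral_mat_def by (simp add: sum_distrib_right) (simp add: mult_ac)
  also have "\<dots> = (\<Sum>a\<in>UNIV. \<Sum>i\<in>UNIV. \<Sum>b\<in>UNIV. g (l i) * (u i $ b * (B $ b $ a * u i $ a)))"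
    by (rule sum.cong, rule refl, rule sum.swap)
  also have "\<dots> = (\<Sum>i\<in>UNIV. \<Sum>a\<in>UNIV. \<Sum>b\<in>UNIV. g (l i) * (u i $ b * (B $ b $ a * u i $ a)))"
    by (rule sum.swap)
  also have "\<dots> = (\<Sum>i\<in>UNIV. \<Sum>b\<in>UNIV. \<Sum>a\<in>UNIV. g (l i) * (u i $ b * (B $ b $ a * u i $ a)))"
    by (rule sum.cong, rule refl, rule sum.swap)
  finally show ?thesis by (simp add: inner_vec_def matrix_vector_mult_def sum_distrib_left)
qed

lemma mat_inner_spectral_mat_eigen:
  fixes u v :: "'n::finite \<Rightarrow> real^'n"
  assumes "eigen_system B k v"
  shows "mat_inner (spectral_mat g l u) B = (\<Sum>i\<in>UNIV. \<Sum>j\<in>UNIV. g (l i) * k j * (v j \<bullet> u i)\<^sup>2)"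
  by (simp add: mat_inner_spectral_mat eigen_system_quadratic[OF assms] sum_distrib_left mult.assoc)

lemma mat_inner_psd_nonneg:
  assumes "A \<in> psd_mats" "B \<in> psd_mats"
  shows "0 \<le> mat_inner A B"
proof -
  obtain l u where e: "eigen_system A l u"
    using eigen_system_exists assms(1) unfolding psd_mats_def by blast
  have "mat_inner A B = (\<Sum>i\<in>UNIV. l i * (u i \<bullet> (B *v u i)))"
    using mat_inner_spectral_mat[of "\<lambda>x. x" l u B] by (simp add: eigen_system_spectral_mat[OF e])
  also have "\<dots> \<ge> 0"
    using assms(2) eigen_system_psd_mats[OF e assms(1)]
    by (intro sum_nonneg mult_nonneg_nonneg) (auto simp: psd_mats_def)
  finally show ?thesis .
qed

section \<open>Trace inequalities from pairs of eigenbases\<close>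

text \<open>The weights \<open>(v j \<bullet> u i)\<^sup>2\<close> of two eigenbases form a doubly stochastic matrix, which turns the
  trace inequalities below into scalar ones.\<close>

lemma doubly_stochastic_left:
  fixes u v :: "'n::finite \<Rightarrow> real^'n"
  assumes "orthonormal u" "orthonormal v"
  shows "(\<Sum>i\<in>UNIV. \<Sum>j\<in>UNIV. f i * (v j \<bullet> u i)\<^sup>2) = (\<Sum>i\<in>UNIV. f i)"
  by (simp add: sum_distrib_left[symmetric] sum_sqr_inner_orthonormal[OF assms(2,1)])

lemma doubly_stochastic_right:
  fixes u v :: "'n::finite \<Rightarrow> real^'n"
  assumes "orthonormal u" "orthonormal v"
  shows "(\<Sum>i\<in>UNIV. \<Sum>j\<in>UNIV. f j * (v j \<bullet> u i)\<^sup>2) = (\<Sum>j\<in>UNIV. f j)"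
  using doubly_stochastic_left[OF assms(2,1), of f]
  by (subst sum.swap) (simp add: inner_commute)

lemma norm_sqr_eq_sum_orthonormal:
  fixes M :: "real^'n^'n"
  assumes "orthonormal u"
  shows "(norm M)\<^sup>2 = (\<Sum>i\<in>UNIV. (norm (M *v u i))\<^sup>2)"
proof -
  have "(norm M)\<^sup>2 = (\<Sum>a\<in>UNIV. M $ a \<bullet> M $ a)"
    by (simp add: power2_norm_eq_inner inner_vec_def)
  also have "\<dots> = (\<Sum>a\<in>UNIV. \<Sum>i\<in>UNIV. (u i \<bullet> M $ a) * (u i \<bullet> M $ a))"
    by (simp add: orthonormal_parseval[OF assms])
  also have "\<dots> = (\<Sum>i\<in>UNIV. \<Sum>a\<in>UNIV. (u i \<bullet> M $ a) * (u i \<bullet> M $ a))"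
    by (rule sum.swap)
  also have "\<dots> = (\<Sum>i\<in>UNIV. (norm (M *v u i))\<^sup>2)"
    by (simp add: power2_norm_eq_inner inner_vec_def[of "_ *v _"] matrix_vector_mul_component
        inner_commute)
  finally show ?thesis .
qed

text \<open>Tested with \<open>v j\<close> on the left and \<open>u i\<close> on the right, B - A
  has the entry (k j - l i) (v j . u i), whether or not A and B commute. The Frobenius norm can be
  computed from these mixed entries.\<close>

lemma norm_sqr_diff_eigen_systems:
  fixes A B :: "real^'n^'n"
  assumes A: "eigen_system A l u" and B: "B \<in> sym_mats" "eigen_system B k v"
  shows "(norm (B - A))\<^sup>2 = (\<Sum>i\<in>UNIV. \<Sum>j\<in>UNIV. (k j - l i)\<^sup>2 * (v j \<bullet> u i)\<^sup>2)"
proof -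
  have on: "orthonormal u" "orthonormal v" using A B by (auto simp: eigen_system_def)
  have *: "v j \<bullet> ((B - A) *v u i) = (k j - l i) * (v j \<bullet> u i)" for i j
    using A B inner_sym_mats[OF B(1), of "v j" "u i"]
    by (simp add: eigen_system_def matrix_vector_mult_diff_rdistrib inner_diff_right left_diff_distrib)
  have "(norm ((B - A) *v u i))\<^sup>2 = (\<Sum>j\<in>UNIV. (k j - l i)\<^sup>2 * (v j \<bullet> u i)\<^sup>2)" for i
    using orthonormal_parseval[OF on(2), of "(B - A) *v u i" "(B - A) *v u i"]
    by (simp add: * power2_norm_eq_inner power_mult_distrib[symmetric]) (simp add: power2_eq_square)
  then show ?thesis by (simp add: norm_sqr_eq_sum_orthonormal[OF on(1)])
qed

lemma mat_inner_diff_right: "mat_inner Y (V - U) = mat_inner Y V - mat_inner Y U"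
  by (simp add: mat_inner_alt sum_subtractf algebra_simps)

lemma mat_inner_diff_left: "mat_inner (V - U) Y = mat_inner V Y - mat_inner U Y"
  by (simp add: mat_inner_alt sum_subtractf algebra_simps)

lemma mat_inner_scaleR_right: "mat_inner Y (r *\<^sub>R V) = r * mat_inner Y V"
  by (simp add: mat_inner_alt sum_distrib_left mult_ac)

lemma mat_inner_sym_eq_inner:
  assumes "Y \<in> sym_mats"
  shows "mat_inner Y = (\<lambda>V. V \<bullet> Y)"
  using mat_inner_eq_inner[OF assms] by (auto simp: mat_inner_commute[of Y])

lemma subspace_sym_mats: "subspace (sym_mats :: (real^'n^'n) set)"
  by (auto simp: subspace_def sym_mats_def transpose_def vec_eq_iff)

text \<open>The bridge from matrices to scalars: double stochasticity lets both spectral sums be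
  rewritten over pairs (i, j) with the same weights as the trace term. Sign or size estimates for
  the scalar remainder then transfer directly.\<close>

lemma spectral_sum_remainder:
  fixes U V :: "real^'n^'n"
  assumes U: "U \<in> sym_mats" "eigen_system U l u" and V: "V \<in> sym_mats" "eigen_system V k v"
  shows "spectral_sum f V - spectral_sum f U - mat_inner (spectral_mat g l u) (V - U) =
    (\<Sum>i\<in>UNIV. \<Sum>j\<in>UNIV. (f (k j) - f (l i) - g (l i) * (k j - l i)) * (v j \<bullet> u i)\<^sup>2)"
proof -
  have on: "orthonormal u" "orthonormal v" using U V by (auto simp: eigen_system_def)
  have "mat_inner (spectral_mat g l u) U = (\<Sum>i\<in>UNIV. g (l i) * l i)"
    using U by (simp add: mat_inner_spectral_mat eigen_system_def orthonormal_def)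
  moreover have "(\<Sum>i\<in>UNIV. \<Sum>j\<in>UNIV. (f (k j) - f (l i) - g (l i) * (k j - l i)) * (v j \<bullet> u i)\<^sup>2) =
     (\<Sum>i\<in>UNIV. \<Sum>j\<in>UNIV. f (k j) * (v j \<bullet> u i)\<^sup>2) - (\<Sum>i\<in>UNIV. \<Sum>j\<in>UNIV. f (l i) * (v j \<bullet> u i)\<^sup>2)
     - (\<Sum>i\<in>UNIV. \<Sum>j\<in>UNIV. g (l i) * k j * (v j \<bullet> u i)\<^sup>2)
     + (\<Sum>i\<in>UNIV. \<Sum>j\<in>UNIV. (g (l i) * l i) * (v j \<bullet> u i)\<^sup>2)"
    by (simp add: left_diff_distrib right_diff_distrib sum_subtractf mult.assoc)
  ultimately show ?thesis
    by (simp add: spectral_sum_eigen_system[OF U] spectral_sum_eigen_system[OF V]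
        mat_inner_diff_right mat_inner_spectral_mat_eigen[OF V(2)]
        doubly_stochastic_left[OF on] doubly_stochastic_right[OF on])
qed

text \<open>Klein's inequality in concave form. The scalar tangent inequality is asked for only at
  pairs of eigenvalues.\<close>

lemma spectral_sum_klein:
  fixes U V :: "real^'n^'n"
  assumes "U \<in> sym_mats" "eigen_system U l u" and "V \<in> sym_mats" "eigen_system V k v"
    and "\<And>i j. f (k j) \<le> f (l i) + g (l i) * (k j - l i)"
  shows "spectral_sum f V \<le> spectral_sum f U + mat_inner (spectral_mat g l u) (V - U)"
proof -
  have "spectral_sum f V - spectral_sum f U - mat_inner (spectral_mat g l u) (V - U) \<le> 0"
    unfolding spectral_sum_remainder[OF assms(1-4)]
    using assms(5) by (intro sum_nonpos mult_nonpos_nonneg) (auto simp: diff_le_eq add.commute)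
  then show ?thesis by simp
qed

text \<open>The dual objective contains the negative of the conjugate, so a lower bound on
  \<open>H_conj\<close> bounds it from above. The real numbers \<open>q i\<close> stand for lower
  bounds of \<open>h_conj\<close>, which keeps the computation out of \<open>ereal\<close>.\<close>

lemma H_conj_spectral_mat_ge:
  fixes l :: "'n::finite \<Rightarrow> real"
  assumes on: "orthonormal u" and q: "\<And>i a. a \<ge> 0 \<Longrightarrow> q i \<le> g (l i) * a - h a"
  shows "ereal (\<Sum>i\<in>UNIV. q i) \<le> H_conj h (spectral_mat g l u)"
  unfolding H_conj_def concave_conj_def
proof (rule INF_greatest, simp only: ereal_less_eq)
  fix V :: "real^'n^'n" assume V: "V \<in> psd_mats"
  then have sV: "V \<in> sym_mats" by (simp add: psd_mats_def)
  obtain k v where e: "eigen_system V k v" using eigen_system_exists[OF sV] .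
  then have on': "orthonormal v" by (simp add: eigen_system_def)
  have "(\<Sum>i\<in>UNIV. q i) = (\<Sum>i\<in>UNIV. \<Sum>j\<in>UNIV. q i * (v j \<bullet> u i)\<^sup>2)"
    by (simp add: doubly_stochastic_left[OF on on'])
  also have "\<dots> \<le> (\<Sum>i\<in>UNIV. \<Sum>j\<in>UNIV. (g (l i) * k j - h (k j)) * (v j \<bullet> u i)\<^sup>2)"
    by (intro sum_mono mult_right_mono q eigen_system_psd_mats[OF e V]) auto
  also have "\<dots> = mat_inner (spectral_mat g l u) V - spectral_sum h V"
    by (simp add: mat_inner_spectral_mat_eigen[OF e] spectral_sum_eigen_system[OF sV e]
        left_diff_distrib sum_subtractf doubly_stochastic_right[OF on on'])
  finally show "(\<Sum>i\<in>UNIV. q i) \<le> mat_inner (spectral_mat g l u) V - spectral_sum h V" .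
qed

section \<open>Differentiability of spectral sums\<close>

text \<open>In \<open>spectral_sum_remainder\<close> an eigenvalue \<open>k j\<close> is paired with
  every \<open>l i\<close>, also with distant ones, so a local little-o estimate is not enough. Far
  from x the Lipschitz bound is absorbed into the quadratic term because |a - x| >= d there.\<close>

lemma has_real_derivative_lipschitz_remainder:
  fixes f :: "real \<Rightarrow> real"
  assumes d: "(f has_real_derivative D) (at x)" and lip: "\<And>a b. \<bar>f a - f b\<bar> \<le> C * \<bar>a - b\<bar>" and "e > 0"
  obtains K where "K \<ge> 0" "\<And>a. \<bar>f a - f x - D * (a - x)\<bar> \<le> e * \<bar>a - x\<bar> + K * (a - x)\<^sup>2"
proof -
  have "\<exists>d>0. \<forall>a. \<bar>a - x\<bar> < d \<longrightarrow> \<bar>f a - f x - D * (a - x)\<bar> \<le> e * \<bar>a - x\<bar>"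
    using assms(1,3) unfolding has_field_derivative_def has_derivative_at_alt real_norm_def by blast
  then obtain d where d: "d > 0" "\<And>a. \<bar>a - x\<bar> < d \<Longrightarrow> \<bar>f a - f x - D * (a - x)\<bar> \<le> e * \<bar>a - x\<bar>"
    by blast
  have C: "C \<ge> 0" using lip[of 1 0] by simp
  define K where "K = (C + \<bar>D\<bar>) / d"
  have K: "K \<ge> 0" using d C by (simp add: K_def)
  have "\<bar>f a - f x - D * (a - x)\<bar> \<le> e * \<bar>a - x\<bar> + K * (a - x)\<^sup>2" for a
  proof (cases "\<bar>a - x\<bar> < d")
    case True
    then show ?thesis using d(2)[OF True] mult_nonneg_nonneg[OF K zero_le_power2[of "a - x"]] by linarith
  next
    case False
    have "\<bar>f a - f x - D * (a - x)\<bar> \<le> (C + \<bar>D\<bar>) * \<bar>a - x\<bar>"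
      using lip[of a x] abs_triangle_ineq4[of "f a - f x" "D * (a - x)"]
      by (simp add: abs_mult distrib_right)
    also have "\<dots> = K * (d * \<bar>a - x\<bar>)" using d by (simp add: K_def)
    also have "\<dots> \<le> K * (\<bar>a - x\<bar> * \<bar>a - x\<bar>)"
      using False K by (intro mult_left_mono mult_right_mono) auto
    also have "\<dots> = K * (a - x)\<^sup>2" by (simp add: power2_eq_square)
    finally show ?thesis
      using mult_nonneg_nonneg[OF less_imp_le[OF \<open>e > 0\<close>] abs_ge_zero[of "a - x"]] by linarith
  qed
  with K that show ?thesis by blast
qed

text \<open>Far pairs of eigenvalues are harmless because their weights are small: the weighted sum
  of (k j - l i)^2 equals the squared norm of V - U. No eigenvalue or eigenvector has to be followed
  continuously.\<close>

lemma has_derivative_spectral_sum: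
  fixes U :: "real^'n^'n"
  assumes U: "U \<in> sym_mats" "eigen_system U l u"
    and d: "\<And>i. (f has_real_derivative g (l i)) (at (l i))"
    and lip: "\<And>a b. \<bar>f a - f b\<bar> \<le> C * \<bar>a - b\<bar>"
  shows "(spectral_sum f has_derivative mat_inner (spectral_mat g l u)) (at U within sym_mats)"
  unfolding has_derivative_within_alt
proof (intro conjI allI impI)
  show "bounded_linear (mat_inner (spectral_mat g l u))"
    unfolding mat_inner_sym_eq_inner[OF spectral_mat_sym] by (rule bounded_linear_inner_left)
  fix e :: real assume "e > 0"
  define n where "n = real CARD('n)"
  \<comment> \<open>This leaves e s / 2 for the linear part of the remainder, s being the norm of V
    - U: n e' s / 2 from the constant halves of AM-GM and e' s / 2 from its quadratic
    halves.\<close>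
  define e' where "e' = e / (n + 1)"
  have n: "n \<ge> 0" and e': "e' > 0" "e' * (n + 1) = e"
    using \<open>e > 0\<close> by (auto simp: e'_def n_def add_nonneg_pos)
  have "\<exists>K. K \<ge> 0 \<and> (\<forall>a. \<bar>f a - f (l i) - g (l i) * (a - l i)\<bar> \<le> e' * \<bar>a - l i\<bar> + K * (a - l i)\<^sup>2)" for i
    using has_real_derivative_lipschitz_remainder[OF d lip e'(1)] by metis
  then obtain K where K: "\<And>i. K i \<ge> 0"
    "\<And>i a. \<bar>f a - f (l i) - g (l i) * (a - l i)\<bar> \<le> e' * \<bar>a - l i\<bar> + K i * (a - l i)\<^sup>2"
    by metis
  define L where "L = (\<Sum>i\<in>UNIV. K i)"
  have L: "L \<ge> 0" "K i \<le> L" for i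
    using K(1) by (auto simp: L_def intro: sum_nonneg member_le_sum)
  show "\<exists>d>0. \<forall>V\<in>sym_mats. norm (V - U) < d \<longrightarrow>
    norm (spectral_sum f V - spectral_sum f U - mat_inner (spectral_mat g l u) (V - U)) \<le> e * norm (V - U)"
  \<comment> \<open>This radius gives L s <= e / 2, the share of the quadratic part; L + 1 keeps the
    quotient meaningful when L = 0.\<close>
  proof (intro exI[of _ "e / (2 * (L + 1))"] conjI ballI impI)
    show "0 < e / (2 * (L + 1))" using \<open>e > 0\<close> L(1) by simp
    fix V :: "real^'n^'n" assume V: "V \<in> sym_mats" and close: "norm (V - U) < e / (2 * (L + 1))"
    define s where "s = norm (V - U)"
    obtain k v where e: "eigen_system V k v" using eigen_system_exists[OF V] .
    have on: "orthonormal u" "orthonormal v" using U e by (auto simp: eigen_system_def)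
    let ?w = "\<lambda>i j. (v j \<bullet> u i)\<^sup>2"
    let ?R = "spectral_sum f V - spectral_sum f U - mat_inner (spectral_mat g l u) (V - U)"
    show "norm ?R \<le> e * norm (V - U)"
    proof (cases "s = 0")
      case True
      then show ?thesis by (simp add: s_def mat_inner_alt)
    next
      case False
      then have s: "s > 0" by (simp add: s_def)
      \<comment> \<open>AM-GM in the form \<open>2 \<bar>d\<bar> \<le> s + d\<^sup>2 / s\<close>\<close>
      have amgm: "\<bar>d\<bar> \<le> s / 2 + d\<^sup>2 / (2 * s)" for d
      proof -
        have "0 \<le> (\<bar>d\<bar> - s)\<^sup>2" by simp
        then show ?thesis using s by (simp add: field_simps power2_eq_square)
      qed
      have "\<bar>f (k j) - f (l i) - g (l i) * (k j - l i)\<bar> \<le> e' * s / 2 + (e' / (2 * s) + L) * (k j - l i)\<^sup>2" for i j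
      proof -
        have "\<bar>f (k j) - f (l i) - g (l i) * (k j - l i)\<bar> \<le> e' * \<bar>k j - l i\<bar> + K i * (k j - l i)\<^sup>2"
          by (rule K)
        also have "\<dots> \<le> e' * (s / 2 + (k j - l i)\<^sup>2 / (2 * s)) + L * (k j - l i)\<^sup>2"
          using e' L by (intro add_mono mult_left_mono amgm mult_right_mono) auto
        finally show ?thesis by (simp add: algebra_simps)
      qed
      then have "\<bar>(f (k j) - f (l i) - g (l i) * (k j - l i)) * ?w i j\<bar> \<le>
          (e' * s / 2 + (e' / (2 * s) + L) * (k j - l i)\<^sup>2) * ?w i j" for i j
        unfolding abs_mult abs_power2 by (intro mult_right_mono) auto
      then have "\<bar>?R\<bar> \<le> (\<Sum>i\<in>UNIV. \<Sum>j\<in>UNIV. (e' * s / 2 + (e' / (2 * s) + L) * (k j - l i)\<^sup>2) * ?w i j)"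
        unfolding spectral_sum_remainder[OF U V e]
        by (intro sum_mono order_trans[OF sum_abs])
      also have "\<dots> = (\<Sum>i\<in>UNIV. \<Sum>j\<in>UNIV. (e' * s / 2) * ?w i j)
          + (e' / (2 * s) + L) * (\<Sum>i\<in>UNIV. \<Sum>j\<in>UNIV. (k j - l i)\<^sup>2 * ?w i j)"
        by (simp only: distrib_right sum.distrib sum_distrib_left mult.assoc)
      also have "\<dots> = n * (e' * s / 2) + (e' / (2 * s) + L) * s\<^sup>2"
        unfolding doubly_stochastic_left[OF on, of "\<lambda>_. e' * s / 2"]
        by (simp add: s_def n_def norm_sqr_diff_eigen_systems[OF U(2) V e])
      also have "\<dots> = (e' * (n + 1) / 2 + L * s) * s"
        using s by (simp add: field_simps power2_eq_square)
      also have "\<dots> \<le> (e / 2 + e / 2) * s"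
      proof (intro mult_right_mono add_mono)
        have "L * s \<le> (L + 1) * (e / (2 * (L + 1)))"
          using L close s by (intro mult_mono) (auto simp: s_def)
        also have "\<dots> = e / 2" using L(1) by (simp add: field_simps)
        finally show "L * s \<le> e / 2" .
      qed (use e' s in auto)
      finally show ?thesis by (simp add: s_def)
    qed
  qed
qed

text \<open>A derivative within \<open>sym_mats\<close> is determined only along symmetric
  directions. Comparing two candidates Y and Z along W = Z - Y, which is symmetric, gives W . W = 0,
  so the definite description is justified.\<close>

lemma sym_gradient_eqI:
  fixes U :: "real^'n^'n"
  assumes U: "U \<in> sym_mats" and Y: "Y \<in> sym_mats"
    and d: "(F has_derivative mat_inner Y) (at U within sym_mats)"
  shows "sym_gradient F U = Y"
  unfolding sym_gradient_def
proof (rule the_equality)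
  show "Y \<in> sym_mats \<and> (F has_derivative mat_inner Y) (at U within sym_mats)" using Y d by simp
  fix Z assume Z: "Z \<in> sym_mats \<and> (F has_derivative mat_inner Z) (at U within sym_mats)"
  define W where "W = Z - Y"
  have W: "W \<in> sym_mats" using Y Z subspace_diff[OF subspace_sym_mats] by (auto simp: W_def)
  have *: "((\<lambda>t. F (U + t *\<^sub>R W)) has_derivative (\<lambda>t. mat_inner X (t *\<^sub>R W))) (at 0)"
    if "(F has_derivative mat_inner X) (at U within sym_mats)" for X
  proof -
    have 1: "((\<lambda>t. U + t *\<^sub>R W) has_derivative (\<lambda>t. t *\<^sub>R W)) (at 0)"
      by (auto intro!: derivative_eq_intros)
    have "range (\<lambda>t. U + t *\<^sub>R W) \<subseteq> sym_mats"
      using U W subspace_sym_mats by (auto intro!: subspace_add subspace_scale)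
    then have "(F has_derivative mat_inner X) (at (U + 0 *\<^sub>R W) within range (\<lambda>t. U + t *\<^sub>R W))"
      using that by (auto intro: has_derivative_subset)
    from has_derivative_in_compose[OF 1 this] show ?thesis .
  qed
  have "(\<lambda>t. mat_inner Z (t *\<^sub>R W)) = (\<lambda>t. mat_inner Y (t *\<^sub>R W))"
    using has_derivative_unique *[of Z] *[of Y] Z d by blast
  then have "mat_inner Z (1 *\<^sub>R W) = mat_inner Y (1 *\<^sub>R W)" by metis
  then have "W \<bullet> W = 0"
    using W by (simp add: mat_inner_eq_inner W_def inner_diff_left)
  then show "Z = Y" by (simp add: W_def)
qed

section \<open>Operator antitone slopes\<close>

text \<open>Leaving out s = 1 keeps the denominator positive for every t >= 0, including t =
  0.\<close>

definition kern :: "real \<Rightarrow> real \<Rightarrow> real" where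
  "kern t s = indicator {0..<1} s / (t * s + (1 - s))"

text \<open>A real-valued form of the measure constraint: \<open>has_bochner_integral\<close>
  bundles integrability with the value, as dominated convergence and monotonicity of integrals
  require.\<close>

definition stieltjes :: "real measure \<Rightarrow> (real \<Rightarrow> real) \<Rightarrow> bool" where
  "stieltjes \<mu> y \<longleftrightarrow> sets \<mu> = sets borel \<and> (\<forall>t\<ge>0. has_bochner_integral \<mu> (kern t) (y t))"

lemma kern_nonneg: "t \<ge> 0 \<Longrightarrow> 0 \<le> kern t s"
  by (auto simp: kern_def indicator_def)

lemma kern_antimono:
  assumes "0 \<le> s" "s \<le> t"
  shows "kern t r \<le> kern s r"
  using assms by (auto simp: kern_def indicator_def intro!: divide_left_mono mult_right_mono mult_pos_pos add_nonneg_pos)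

lemma kern_measurable [measurable]: "kern t \<in> borel_measurable borel"
  unfolding kern_def by measurable

text \<open>A finite value at \<open>0\<close> forces \<open>\<mu> {1} = 0\<close>, so the half-open kernel represents \<open>y\<close> as well.\<close>

lemma surrogate_feasible_stieltjes:
  assumes "surrogate_feasible h \<gamma> \<rho>2 umax \<beta> y \<mu>"
  shows "stieltjes \<mu> y"
proof -
  have sets: "sets \<mu> = sets borel" and y0: "\<And>t. t \<ge> 0 \<Longrightarrow> 0 \<le> y t"
    and y: "\<And>t. t \<ge> 0 \<Longrightarrow> ennreal (y t) = (\<integral>\<^sup>+l\<in>{0..1}. inverse (ennreal (t * l + (1 - l))) \<partial>\<mu>)"
    using assms by (auto simp: surrogate_feasible_def)
  note [measurable_cong] = sets
  have space: "space \<mu> = UNIV" using sets by (metis sets_eq_imp_space_eq space_borel)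
  have "\<infinity> * emeasure \<mu> {1} = (\<integral>\<^sup>+l. \<infinity> * indicator {1} l \<partial>\<mu>)"
    by (subst nn_integral_cmult_indicator) (auto simp: sets)
  also have "\<dots> \<le> (\<integral>\<^sup>+l\<in>{0..1}. inverse (ennreal (0 * l + (1 - l))) \<partial>\<mu>)"
    by (intro nn_integral_mono) (auto simp: indicator_def)
  also have "\<dots> < \<infinity>" using y[of 0] by (metis ennreal_less_top infinity_ennreal_def order_refl)
  finally have "emeasure \<mu> {1} = 0" by (auto simp: ennreal_mult_eq_top_iff ennreal_top_mult split: if_splits)
  then have ae: "AE l in \<mu>. l \<noteq> 1"
    by (intro AE_I[of _ _ "{1}"]) (auto simp: sets)
  show ?thesis unfolding stieltjes_def
  proof (intro conjI allI impI sets has_bochner_integral_nn_integral)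
    fix t :: real assume t: "t \<ge> 0"
    show "kern t \<in> borel_measurable \<mu>" by measurable
    show "AE x in \<mu>. 0 \<le> kern t x" using t by (simp add: kern_nonneg)
    show "0 \<le> y t" using t y0 by simp
    have "ennreal (kern t l) = inverse (ennreal (t * l + (1 - l))) * indicator {0..1} l" if "l \<noteq> 1" for l
    proof (cases "l \<in> {0..<1}")
      case True
      then have "t * l + (1 - l) > 0" using t by (intro add_nonneg_pos) auto
      from inverse_ennreal[OF this] show ?thesis
        using True by (simp add: kern_def inverse_eq_divide del: ennreal_plus)
    next
      case False
      then show ?thesis using that by (auto simp: kern_def indicator_def)
    qed
    then have "(\<integral>\<^sup>+l. ennreal (kern t l) \<partial>\<mu>) = (\<integral>\<^sup>+l\<in>{0..1}. inverse (ennreal (t * l + (1 - l))) \<partial>\<mu>)"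
      using ae by (intro nn_integral_cong_AE) auto
    then show "(\<integral>\<^sup>+l. ennreal (kern t l) \<partial>\<mu>) = ennreal (y t)" using y t by simp
  qed
qed

lemma stieltjes_nonneg:
  assumes "stieltjes \<mu> y" "t \<ge> 0"
  shows "0 \<le> y t"
  using assms integral_nonneg_AE[of "kern t" \<mu>]
  by (auto simp: stieltjes_def kern_nonneg has_bochner_integral_iff)

lemma stieltjes_antimono:
  assumes "stieltjes \<mu> y" "0 \<le> s" "s \<le> t"
  shows "y t \<le> y s"
proof -
  have "has_bochner_integral \<mu> (kern t) (y t)" "has_bochner_integral \<mu> (kern s) (y s)"
    using assms by (auto simp: stieltjes_def)
  then show ?thesis using integral_mono[of \<mu> "kern t" "kern s"] kern_antimono[OF assms(2,3)]
    by (simp add: has_bochner_integral_iff)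
qed

lemma stieltjes_continuous_on:
  assumes "stieltjes \<mu> y"
  shows "continuous_on {0..} y"
proof (rule continuous_on_sequentiallyI)
  fix t :: "nat \<Rightarrow> real" and a
  assume t: "\<forall>n. t n \<in> {0..}" "a \<in> {0..}" "t \<longlonglongrightarrow> a"
  have b: "has_bochner_integral \<mu> (kern s) (y s)" if "s \<ge> 0" for s
    using assms that by (auto simp: stieltjes_def)
  have "(\<lambda>n. integral\<^sup>L \<mu> (kern (t n))) \<longlonglongrightarrow> integral\<^sup>L \<mu> (kern a)"
  \<comment> \<open>The kernels decrease in t, so \<open>kern 0\<close> dominates them all; its
    integral is the finite number \<open>y 0\<close>.\<close>
  proof (rule integral_dominated_convergence[where w = "kern 0"])
    show "integrable \<mu> (kern 0)" using b[of 0] by (simp add: has_bochner_integral_iff)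
    show "kern a \<in> borel_measurable \<mu>" "\<And>n. kern (t n) \<in> borel_measurable \<mu>"
      using b t by (auto simp: has_bochner_integral_iff)
    show "AE s in \<mu>. (\<lambda>n. kern (t n) s) \<longlonglongrightarrow> kern a s"
    proof (intro always_eventually allI)
      fix s
      have "s \<in> {0..<1} \<Longrightarrow> a * s + (1 - s) > 0" using t by (auto intro: add_nonneg_pos)
      then show "(\<lambda>n. kern (t n) s) \<longlonglongrightarrow> kern a s"
        unfolding kern_def by (cases "s \<in> {0..<1}") (auto intro!: tendsto_intros t(3))
    qed
    show "AE s in \<mu>. norm (kern (t n) s) \<le> kern 0 s" for n
      using t kern_nonneg kern_antimono[of 0 "t n"] by auto
  qed
  then show "(\<lambda>n. y (t n)) \<longlonglongrightarrow> y a" using b t by (simp add: has_bochner_integral_iff)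
qed

text \<open>With \<open>P = s U + (1 - s) I\<close> one has \<open>x \<bullet> P\<^sup>-\<^sup>1 x = sup\<^sub>w (2 x \<bullet> w - w \<bullet> P w)\<close>, and the right-hand side is
  antitone in \<open>P\<close>.\<close>

lemma resolvent_antimono:
  fixes U V :: "real^'n^'n"
  assumes U: "U \<in> psd_mats" "eigen_system U l u" and V: "V \<in> psd_mats" "eigen_system V k v"
    and le: "\<And>w. w \<bullet> (U *v w) \<le> w \<bullet> (V *v w)" and s: "0 \<le> s" "s < 1"
  shows "(\<Sum>j\<in>UNIV. (v j \<bullet> x)\<^sup>2 / (k j * s + (1 - s))) \<le> (\<Sum>i\<in>UNIV. (u i \<bullet> x)\<^sup>2 / (l i * s + (1 - s)))"
proof -
  have on: "orthonormal u" "orthonormal v" using U V by (auto simp: eigen_system_def)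
  define p where "p i = l i * s + (1 - s)" for i
  define q where "q j = k j * s + (1 - s)" for j
  have p: "p i > 0" for i using eigen_system_psd_mats[OF U(2,1)] s by (simp add: p_def add_nonneg_pos)
  have q: "q i > 0" for i using eigen_system_psd_mats[OF V(2,1)] s by (simp add: q_def add_nonneg_pos)
  \<comment> \<open>This is Q^(-1) x for Q = s V + (1 - s) I, the point where the supremum for V is
    attained. For U it is one competitor among others, and completing the square in each coordinate
    bounds its value.\<close>
  define w where "w = (\<Sum>j\<in>UNIV. ((v j \<bullet> x) / q j) *\<^sub>R v j)"
  have vw: "v j \<bullet> w = (v j \<bullet> x) / q j" for j
  proof -
    have "v j \<bullet> w = (\<Sum>i\<in>UNIV. if i = j then (v i \<bullet> x) / q i else 0)"
      using on(2) unfolding w_def inner_sum_right by (intro sum.cong) (auto simp: orthonormal_def)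
    then show ?thesis by simp
  qed
  have ww: "s * (w \<bullet> (M *v w)) + (1 - s) * (w \<bullet> w) = (\<Sum>i\<in>UNIV. (a i * s + (1 - s)) * (b i \<bullet> w)\<^sup>2)"
    if "eigen_system M a b" for M :: "real^'n^'n" and a b
  proof -
    have "w \<bullet> w = (\<Sum>i\<in>UNIV. (b i \<bullet> w)\<^sup>2)"
      using orthonormal_parseval[of b w w] that by (simp add: eigen_system_def power2_eq_square)
    then show ?thesis
      by (simp add: eigen_system_quadratic[OF that] sum_distrib_left sum.distrib[symmetric]
          distrib_right mult_ac)
  qed
  have "(\<Sum>j\<in>UNIV. (v j \<bullet> x)\<^sup>2 / q j) = (\<Sum>j\<in>UNIV. 2 * ((v j \<bullet> x) * (v j \<bullet> w)) - q j * (v j \<bullet> w)\<^sup>2)"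
    using q by (intro sum.cong) (auto simp: vw field_simps power2_eq_square less_imp_neq[symmetric])
  also have "\<dots> = 2 * (x \<bullet> w) - (s * (w \<bullet> (V *v w)) + (1 - s) * (w \<bullet> w))"
    unfolding ww[OF V(2)] by (simp add: sum_subtractf sum_distrib_left[symmetric] orthonormal_parseval[OF on(2)] q_def)
  also have "\<dots> \<le> 2 * (x \<bullet> w) - (s * (w \<bullet> (U *v w)) + (1 - s) * (w \<bullet> w))"
    using le s by (intro diff_left_mono add_right_mono mult_left_mono) auto
  also have "\<dots> = (\<Sum>i\<in>UNIV. 2 * ((u i \<bullet> x) * (u i \<bullet> w)) - p i * (u i \<bullet> w)\<^sup>2)"
    unfolding ww[OF U(2)] by (simp add: sum_subtractf sum_distrib_left[symmetric] orthonormal_parseval[OF on(1)] p_def)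
  also have "\<dots> \<le> (\<Sum>i\<in>UNIV. (u i \<bullet> x)\<^sup>2 / p i)"
  proof (rule sum_mono)
    fix i
    have "0 \<le> (u i \<bullet> x - p i * (u i \<bullet> w))\<^sup>2" by simp
    then show "2 * ((u i \<bullet> x) * (u i \<bullet> w)) - p i * (u i \<bullet> w)\<^sup>2 \<le> (u i \<bullet> x)\<^sup>2 / p i"
      using p[of i] by (simp add: field_simps power2_eq_square)
  qed
  finally show ?thesis by (simp add: p_def q_def)
qed

text \<open>The quadratic form of y(U) is the integral over s of the quadratic forms of the
  resolvents, so the pointwise comparison in \<open>resolvent_antimono\<close> can be
  integrated.\<close>

lemma stieltjes_operator_antimono:
  fixes U V :: "real^'n^'n"
  assumes y: "stieltjes \<mu> y"
    and U: "U \<in> psd_mats" "eigen_system U l u" and V: "V \<in> psd_mats" "eigen_system V k v"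
    and le: "\<And>w. w \<bullet> (U *v w) \<le> w \<bullet> (V *v w)"
  shows "x \<bullet> (spectral_mat y k v *v x) \<le> x \<bullet> (spectral_mat y l u *v x)"
proof -
  have on: "orthonormal u" "orthonormal v" using U V by (auto simp: eigen_system_def)
  have b: "has_bochner_integral \<mu> (\<lambda>s. \<Sum>i\<in>UNIV. kern (a i) s * (b i \<bullet> x)\<^sup>2) (x \<bullet> (spectral_mat y a b *v x))"
    if "M \<in> psd_mats" "eigen_system M a b" for M :: "real^'n^'n" and a b
    unfolding eigen_system_quadratic[OF spectral_mat_eigen_system[OF that(2)[unfolded eigen_system_def, THEN conjunct1]]]
    using y eigen_system_psd_mats[OF that(2,1)]
    by (intro has_bochner_integral_sum has_bochner_integral_mult_left) (auto simp: stieltjes_def)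
  have "(\<Sum>i\<in>UNIV. kern (k i) s * (v i \<bullet> x)\<^sup>2) \<le> (\<Sum>i\<in>UNIV. kern (l i) s * (u i \<bullet> x)\<^sup>2)" for s
    using resolvent_antimono[OF U V le, of s x] by (cases "s \<in> {0..<1}") (auto simp: kern_def)
  then show ?thesis
    using b[OF V] b[OF U] by (metis (no_types, lifting) has_bochner_integral_iff integral_mono)
qed

section \<open>Surrogate functions\<close>

text \<open>Extending g to the left by the constant \<open>g 0\<close> turns both branches of
  \<open>hS g\<close> into one integral from a base point below both u and 0. The derivative is
  therefore two-sided even at 0, as gradients at singular matrices require: symmetric neighbours may
  have negative eigenvalues.\<close>

lemma has_real_derivative_hS:
  assumes "continuous_on {0..} g"
  shows "(hS g has_real_derivative g (max 0 u)) (at u)"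
proof -
  define q where "q v = g (max 0 v)" for v
  have q: "continuous_on S q" for S
    unfolding q_def by (rule continuous_on_compose2[OF assms]) (auto intro!: continuous_intros)
  have int: "q integrable_on {a..b}" for a b by (intro integrable_continuous_real q)
  define a where "a = - \<bar>u\<bar> - 1"
  have a: "a < u" "a < 0" by (auto simp: a_def)
  have eq: "hS g w = integral {a..w} q - integral {a..0} q" if "w > a" for w
  proof (cases "w < 0")
    case True
    have "integral {w..0} q = integral {w..0} (\<lambda>_. g 0)"
      by (intro integral_cong) (auto simp: q_def max_def)
    moreover have "integral {a..w} q + integral {w..0} q = integral {a..0} q"
      using True that by (intro Henstock_Kurzweil_Integration.integral_combine int) auto
    ultimately show ?thesis using True by (simp add: hS_def mult.commute)
  next
    case False
    have "integral {0..w} q = integral {0..w} g"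
      by (intro integral_cong) (auto simp: q_def max_def)
    moreover have "integral {a..0} q + integral {0..w} q = integral {a..w} q"
      using False a by (intro Henstock_Kurzweil_Integration.integral_combine int) auto
    ultimately show ?thesis using False by (simp add: hS_def)
  qed
  have "((\<lambda>w. integral {a..w} q) has_real_derivative q u) (at u within {a..u + 1})"
    using a by (intro integral_has_real_derivative q) auto
  then have "((\<lambda>w. integral {a..w} q) has_real_derivative q u) (at u)"
    using a at_within_interior[of u "{a..u + 1}"] by (simp add: interior_atLeastAtMost_real)
  then have "((\<lambda>w. integral {a..w} q - integral {a..0} q) has_real_derivative q u) (at u)"
    by (auto intro!: derivative_eq_intros)
  moreover have "eventually (\<lambda>w. hS g w = integral {a..w} q - integral {a..0} q) (nhds u)"
    using eventually_nhds_in_open[of "{a<..}" u] a(1) eq by (auto elim: eventually_mono)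
  ultimately show ?thesis unfolding q_def[symmetric]
    by (subst DERIV_cong_ev[OF refl _ refl]) auto
qed

lemma tangent_above:
  fixes f f' :: "real \<Rightarrow> real"
  assumes d: "\<And>x. (f has_real_derivative f' x) (at x)" and anti: "\<And>x y. x \<le> y \<Longrightarrow> f' y \<le> f' x"
  shows "f b \<le> f a + f' a * (b - a)"
proof (cases a b rule: linorder_cases)
  case less
  obtain w where w: "a < w" "w < b" "f b - f a = (b - a) * f' w" using MVT2[OF less d] by blast
  have "(b - a) * f' w \<le> (b - a) * f' a" using anti[of a w] w by (intro mult_left_mono) auto
  then show ?thesis using w(3) by (simp add: algebra_simps)
next
  case greater
  obtain w where w: "b < w" "w < a" "f a - f b = (a - b) * f' w" using MVT2[OF greater d] by blast
  have "(a - b) * f' a \<le> (a - b) * f' w" using anti[of w a] w by (intro mult_left_mono) auto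
  then show ?thesis using w(3) by (simp add: algebra_simps)
qed simp

lemma stieltjes_hS_tangent:
  assumes "stieltjes \<mu> y" "a \<ge> 0"
  shows "hS y b \<le> hS y a + y a * (b - a)"
  using tangent_above[OF has_real_derivative_hS[OF stieltjes_continuous_on[OF assms(1)]], of b a]
    stieltjes_antimono[OF assms(1)] assms(2)
  by (simp add: max.mono)

lemma stieltjes_hS_lipschitz:
  assumes y: "stieltjes \<mu> y"
  shows "\<bar>hS y a - hS y b\<bar> \<le> y 0 * \<bar>a - b\<bar>"
proof -
  have "norm (hS y a - hS y b) \<le> y 0 * norm (a - b)"
  proof (rule field_differentiable_bound[where S = UNIV and f' = "\<lambda>u. y (max 0 u)"])
    fix u
    show "(hS y has_real_derivative y (max 0 u)) (at u within UNIV)"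
      using has_real_derivative_hS[OF stieltjes_continuous_on[OF y]] by simp
    show "norm (y (max 0 u)) \<le> y 0"
      using stieltjes_nonneg[OF y, of "max 0 u"] stieltjes_antimono[OF y, of 0 "max 0 u"] by simp
  qed auto
  then show ?thesis by simp
qed

lemma sym_gradient_spectral_sum_hS:
  fixes U :: "real^'n^'n"
  assumes y: "stieltjes \<mu> y" and U: "U \<in> psd_mats" "eigen_system U l u"
  shows "sym_gradient (spectral_sum (hS y)) U = spectral_mat y l u"
proof (rule sym_gradient_eqI)
  show "U \<in> sym_mats" using U by (simp add: psd_mats_def)
  then show "(spectral_sum (hS y) has_derivative mat_inner (spectral_mat y l u)) (at U within sym_mats)"
  proof (rule has_derivative_spectral_sum[OF _ U(2)])
    show "(hS y has_real_derivative y (l i)) (at (l i))" for i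
      using has_real_derivative_hS[OF stieltjes_continuous_on[OF y], of "l i"]
        eigen_system_psd_mats[OF U(2,1), of i] by simp
  qed (rule stieltjes_hS_lipschitz[OF y])
qed (rule spectral_mat_sym)

lemma deriv_hS_0: "stieltjes \<mu> y \<Longrightarrow> deriv (hS y) 0 = y 0"
  using DERIV_imp_deriv[OF has_real_derivative_hS[OF stieltjes_continuous_on, of \<mu> y 0]] by simp

text \<open>The chord from the origin to the point over a + b lies below the graph. Add its heights
  at a and at b.\<close>

lemma concave_on_subadditive:
  fixes h :: "real \<Rightarrow> real"
  assumes "concave_on {0..} h" "h 0 = 0" "a \<ge> 0" "b \<ge> 0"
  shows "h (a + b) \<le> h a + h b"
proof (cases "a + b = 0")
  case False
  have *: "(w / (a + b)) * h (a + b) \<le> h w" if "0 \<le> w" "w \<le> a + b" for w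
  proof -
    have "(1 - w / (a + b)) * h 0 + (w / (a + b)) * h (a + b) \<le> h ((1 - w / (a + b)) *\<^sub>R 0 + (w / (a + b)) *\<^sub>R (a + b))"
      using that assms False by (intro concave_onD[OF assms(1)]) (auto simp: divide_simps)
    then show ?thesis using assms(2) False by simp
  qed
  have "a / (a + b) + b / (a + b) = 1" using False by (simp add: add_divide_distrib[symmetric])
  then have "h (a + b) = (a / (a + b)) * h (a + b) + (b / (a + b)) * h (a + b)"
    by (simp only: distrib_right[symmetric] mult_1_left)
  then show ?thesis using *[of a] *[of b] assms(3,4) by simp
next
  case True
  then have "a = 0" "b = 0" using assms(3,4) by auto
  then show ?thesis using assms(2) by simp
qed

lemma concave_on_sum_le:
  fixes h :: "real \<Rightarrow> real"
  assumes "concave_on {0..} h" "h 0 = 0" "finite I" "\<And>i. i \<in> I \<Longrightarrow> f i \<ge> 0"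
  shows "h (\<Sum>i\<in>I. f i) \<le> (\<Sum>i\<in>I. h (f i))"
  using assms(3,4)
proof (induction)
  case (insert i I)
  then show ?case using concave_on_subadditive[OF assms(1,2), of "f i" "sum f I"]
    by (force simp: sum_nonneg)
qed (simp add: assms)

text \<open>The slope vanishes at 0, so the value 0 on the negative reals is the linear extension,
  and the derivative rule for \<open>hS\<close> covers \<open>GS\<close> too.\<close>

lemma GS_eq_hS: "GS b \<theta> \<gamma> \<rho>1 h' = hS (GS_slope b \<theta> \<gamma> \<rho>1 h')"
  by (auto simp: GS_def hS_def GS_slope_def)

section \<open>The budget surrogate and its differential equation\<close>

locale budget_surrogate =
  fixes b \<theta> \<gamma> \<rho>1 :: real and h h' :: "real \<Rightarrow> real"
  assumes b_pos: "b > 0" and theta_pos: "\<theta> > 0" and gamma_pos: "\<gamma> > 0" and rho1_nonneg: "\<rho>1 \<ge> 0"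
    and h_mono: "mono_on {0..} h"
    and h_deriv: "\<And>u. u \<ge> 0 \<Longrightarrow> (h has_real_derivative h' u) (at u within {0..})"
    and h_0: "h 0 = 0" and h'_0: "h' 0 > 0"
begin

definition "k = \<gamma> / (b + \<rho>1 * \<gamma>)"

text \<open>The integral left after integrating the slope by parts; phrasing it through
  \<open>hS\<close> provides its derivative on the whole line.\<close>

definition "J = hS (\<lambda>v. exp (- k * v) * h (\<theta> * v))"

abbreviation "\<phi> \<equiv> GS_slope b \<theta> \<gamma> \<rho>1 h'"

lemma denom_pos: "b + \<rho>1 * \<gamma> > 0"
  using b_pos gamma_pos rho1_nonneg by (simp add: add_pos_nonneg)

lemma k_pos: "k > 0"
  using gamma_pos denom_pos by (simp add: k_def)

lemma h_continuous: "continuous_on {0..} h"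
  using h_deriv by (intro DERIV_continuous_on) auto

lemma h_scaled_continuous: "continuous_on {0..} (\<lambda>v. h (\<theta> * v))"
  using theta_pos by (intro continuous_on_compose2[OF h_continuous] continuous_intros) auto

text \<open>The positive one-sided derivative gives positive values just to the right of 0, and
  monotonicity propagates them.\<close>

lemma h_pos:
  assumes "u > 0"
  shows "h u > 0"
proof -
  obtain d where d: "d > 0" "\<And>e. e > 0 \<Longrightarrow> 0 + e \<in> {0..} \<Longrightarrow> e < d \<Longrightarrow> h 0 < h (0 + e)"
    using has_real_derivative_pos_inc_right[OF h_deriv[of 0] h'_0] by auto
  define e where "e = min u (d / 2)"
  have e: "0 < e" "e < d" "e \<le> u" using assms d(1) by (auto simp: e_def)
  then have "h e > 0" using d(2)[of e] h_0 by simp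
  then show ?thesis using mono_onD[OF h_mono, of e u] e by simp
qed

lemma h_nonneg: "u \<ge> 0 \<Longrightarrow> h u \<ge> 0"
  using h_pos[of u] h_0 by (cases "u = 0") auto

lemma h_scaled_deriv:
  assumes "v \<ge> 0"
  shows "((\<lambda>v. h (\<theta> * v)) has_real_derivative h' (\<theta> * v) * \<theta>) (at v within {0..})"
proof -
  have "(h has_real_derivative h' (\<theta> * v)) (at (\<theta> * v) within (*) \<theta> ` {0..})"
    using theta_pos assms by (intro has_field_derivative_subset[OF h_deriv]) auto
  then have "(h \<circ> (*) \<theta> has_real_derivative h' (\<theta> * v) * \<theta>) (at v within {0..})"
    by (rule DERIV_image_chain) (auto intro!: derivative_eq_intros)
  then show ?thesis by (simp add: o_def)
qed

lemma J_deriv: "(J has_real_derivative exp (- k * max 0 u) * h (\<theta> * max 0 u)) (at u)"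
  unfolding J_def
  by (intro has_real_derivative_hS continuous_on_mult h_scaled_continuous continuous_intros)

lemma J_0: "J 0 = 0"
  by (simp add: J_def hS_def)

lemma J_pos:
  assumes "u > 0"
  shows "J u > 0"
proof -
  obtain w where "0 < w" "w < u" "J u - J 0 = (u - 0) * (exp (- k * max 0 w) * h (\<theta> * max 0 w))"
    using MVT2[OF assms J_deriv] by blast
  then show ?thesis using assms h_pos[of "\<theta> * w"] theta_pos J_0 by simp
qed

lemma J_mono:
  assumes "u \<le> v"
  shows "J u \<le> J v"
proof (rule DERIV_nonneg_imp_nondecreasing[OF assms])
  fix w
  have "0 \<le> exp (- k * max 0 w) * h (\<theta> * max 0 w)"
    using theta_pos by (intro mult_nonneg_nonneg h_nonneg) auto
  then show "\<exists>y. (J has_real_derivative y) (at w) \<and> 0 \<le> y" using J_deriv by blast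
qed

text \<open>Integration by parts removes h' from the slope. It also shows that the defining integral
  exists: the fundamental theorem integrates the derivative of exp(k (u - v)) h(theta v) / theta
  without continuity of h', and the remaining summand is continuous.\<close>

lemma slope_eq:
  assumes "u \<ge> 0"
  shows "\<phi> u = - (\<gamma> / ((b + \<rho>1 * \<gamma>) * (exp 1 - 1))) * (h (\<theta> * u) + k * (exp (k * u) * J u))"
proof -
  let ?g = "\<lambda>v. exp (- k * v) * h (\<theta> * v)"
  have "continuous_on {0..u} ?g"
    by (intro continuous_on_mult continuous_intros continuous_on_subset[OF h_scaled_continuous]) auto
  then have "(?g has_integral J u) {0..u}"
    using integrable_integral[OF integrable_continuous_real] assms by (auto simp: J_def hS_def)
  from has_integral_mult_right[OF this, of "k * exp (k * u) / \<theta>"]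
  have 1: "((\<lambda>v. k / \<theta> * (exp (k * (u - v)) * h (\<theta> * v))) has_integral k * exp (k * u) / \<theta> * J u) {0..u}"
    by (rule has_integral_eq[rotated]) (simp add: right_diff_distrib exp_diff exp_minus field_simps)
  have 2: "((\<lambda>v. exp (k * (u - v)) * h' (\<theta> * v) - k / \<theta> * (exp (k * (u - v)) * h (\<theta> * v))) has_integral
      (exp (k * (u - u)) * h (\<theta> * u) / \<theta> - exp (k * (u - 0)) * h (\<theta> * 0) / \<theta>)) {0..u}"
  proof (rule fundamental_theorem_of_calculus[OF assms])
    fix v assume v: "v \<in> {0..u}"
    have "((\<lambda>v. h (\<theta> * v)) has_real_derivative h' (\<theta> * v) * \<theta>) (at v within {0..u})"
      using v by (intro has_field_derivative_subset[OF h_scaled_deriv]) auto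
    then have "((\<lambda>v. exp (k * (u - v)) * h (\<theta> * v) / \<theta>) has_real_derivative
        exp (k * (u - v)) * h' (\<theta> * v) - k / \<theta> * (exp (k * (u - v)) * h (\<theta> * v))) (at v within {0..u})"
      using theta_pos by (auto intro!: derivative_eq_intros simp: field_simps)
    then show "((\<lambda>v. exp (k * (u - v)) * h (\<theta> * v) / \<theta>) has_vector_derivative
        exp (k * (u - v)) * h' (\<theta> * v) - k / \<theta> * (exp (k * (u - v)) * h (\<theta> * v))) (at v within {0..u})"
      by (simp add: has_real_derivative_iff_has_vector_derivative)
  qed
  have "((\<lambda>v. exp (k * (u - v)) * h' (\<theta> * v)) has_integral (h (\<theta> * u) / \<theta> + k * exp (k * u) / \<theta> * J u)) {0..u}"
    using has_integral_add[OF 2 1] h_0 by simp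
  then have "\<phi> u = - (\<theta> * \<gamma> / ((b + \<rho>1 * \<gamma>) * (exp 1 - 1))) * (h (\<theta> * u) / \<theta> + k * exp (k * u) / \<theta> * J u)"
    unfolding GS_slope_def k_def[symmetric] by (simp add: integral_unique)
  also have "h (\<theta> * u) / \<theta> + k * exp (k * u) / \<theta> * J u = (h (\<theta> * u) + k * (exp (k * u) * J u)) / \<theta>"
    by (simp add: add_divide_distrib)
  finally show ?thesis using theta_pos by simp
qed

lemma slope_0: "\<phi> 0 = 0"
  by (simp add: GS_slope_def)

lemma slope_continuous: "continuous_on {0..} \<phi>"
proof -
  have "continuous_on {0..} J"
    by (rule DERIV_continuous_on) (rule has_field_derivative_at_within[OF J_deriv])
  then have "continuous_on {0..} (\<lambda>u. - (\<gamma> / ((b + \<rho>1 * \<gamma>) * (exp 1 - 1))) * (h (\<theta> * u) + k * (exp (k * u) * J u)))"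
    by (intro continuous_intros h_scaled_continuous)
  then show ?thesis by (rule continuous_on_eq) (simp add: slope_eq)
qed

lemma GS_deriv: "(GS b \<theta> \<gamma> \<rho>1 h' has_real_derivative \<phi> (max 0 u)) (at u)"
  unfolding GS_eq_hS by (rule has_real_derivative_hS[OF slope_continuous])

lemma deriv_GS: "u \<ge> 0 \<Longrightarrow> deriv (GS b \<theta> \<gamma> \<rho>1 h') u = \<phi> u"
  using DERIV_imp_deriv[OF GS_deriv[of u]] by simp

lemma coeff_pos: "\<gamma> / ((b + \<rho>1 * \<gamma>) * (exp 1 - 1)) > 0"
  using gamma_pos denom_pos by simp

lemma slope_strict_antimono:
  assumes "0 \<le> u" "u < v"
  shows "\<phi> v < \<phi> u"
proof -
  have "exp (k * u) * J u \<le> exp (k * u) * J v" using J_mono assms by simp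
  also have "\<dots> < exp (k * v) * J v" using J_pos[of v] k_pos assms by simp
  finally have "k * (exp (k * u) * J u) < k * (exp (k * v) * J v)" using k_pos by simp
  moreover have "h (\<theta> * u) \<le> h (\<theta> * v)" using assms theta_pos by (intro mono_onD[OF h_mono]) auto
  ultimately have "h (\<theta> * u) + k * (exp (k * u) * J u) < h (\<theta> * v) + k * (exp (k * v) * J v)" by simp
  from mult_strict_left_mono[OF this coeff_pos] show ?thesis using assms by (simp add: slope_eq)
qed

lemma slope_antimono: "0 \<le> u \<Longrightarrow> u \<le> v \<Longrightarrow> \<phi> v \<le> \<phi> u"
  using slope_strict_antimono[of u v] by (cases "u = v") auto

text \<open>The derivative of exp(k u) J(u) is k exp(k u) J(u) + h(theta u), so by
  \<open>slope_eq\<close> the surrogate itself is a multiple of exp(k u) J(u). Substituting this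
  back into \<open>slope_eq\<close> gives the linear differential equation.\<close>

lemma slope_GS:
  assumes "u \<ge> 0"
  shows "(b + \<rho>1 * \<gamma>) * \<phi> u = \<gamma> * GS b \<theta> \<gamma> \<rho>1 h' u - \<gamma> / (exp 1 - 1) * h (\<theta> * u)"
proof -
  let ?c = "- (\<gamma> / ((b + \<rho>1 * \<gamma>) * (exp 1 - 1)))"
  have "(\<phi> has_integral ?c * (exp (k * u) * J u) - ?c * (exp (k * 0) * J 0)) {0..u}"
  proof (rule fundamental_theorem_of_calculus[OF assms])
    fix v assume v: "v \<in> {0..u}"
    have "((\<lambda>v. ?c * (exp (k * v) * J v)) has_real_derivative
       ?c * (exp (k * v) * k * J v + exp (k * max 0 v) * (exp (- k * max 0 v) * h (\<theta> * max 0 v)))) (at v within {0..u})"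
      using v by (intro DERIV_cmult)
        (auto intro!: derivative_eq_intros has_field_derivative_at_within[OF J_deriv])
    also have "?c * (exp (k * v) * k * J v + exp (k * max 0 v) * (exp (- k * max 0 v) * h (\<theta> * max 0 v))) = \<phi> v"
      using v by (simp add: slope_eq exp_minus add.commute mult_ac)
    finally show "((\<lambda>v. ?c * (exp (k * v) * J v)) has_vector_derivative \<phi> v) (at v within {0..u})"
      by (simp add: has_real_derivative_iff_has_vector_derivative)
  qed
  then have GS: "GS b \<theta> \<gamma> \<rho>1 h' u = ?c * (exp (k * u) * J u)"
    using assms J_0 by (simp add: GS_def integral_unique)
  have "(b + \<rho>1 * \<gamma>) * k = \<gamma>" using denom_pos by (simp add: k_def)
  have "\<gamma> * GS b \<theta> \<gamma> \<rho>1 h' u = ((b + \<rho>1 * \<gamma>) * k) * (?c * (exp (k * u) * J u))"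
    unfolding GS \<open>(b + \<rho>1 * \<gamma>) * k = \<gamma>\<close> by (rule refl)
  also have "\<dots> = (b + \<rho>1 * \<gamma>) * (?c * (k * (exp (k * u) * J u)))"
    by (simp only: mult_ac)
  finally have "\<gamma> * GS b \<theta> \<gamma> \<rho>1 h' u = (b + \<rho>1 * \<gamma>) * (?c * (k * (exp (k * u) * J u)))" .
  moreover have "d * (- (\<gamma> / (d * e)) * w) = - (\<gamma> / e * w)" if "d \<noteq> 0" for d e w :: real
    using that by simp
  then have "(b + \<rho>1 * \<gamma>) * (?c * h (\<theta> * u)) = - (\<gamma> / (exp 1 - 1) * h (\<theta> * u))"
    using denom_pos by (metis less_irrefl)
  moreover have "(b + \<rho>1 * \<gamma>) * \<phi> u = (b + \<rho>1 * \<gamma>) * (?c * h (\<theta> * u))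
      + (b + \<rho>1 * \<gamma>) * (?c * (k * (exp (k * u) * J u)))"
    by (simp only: slope_eq[OF assms] distrib_left)
  ultimately show ?thesis by (simp only: diff_conv_add_uminus add.commute)
qed

lemma slope_surj:
  assumes "T \<ge> 0"
  obtains p where "p \<ge> 0" "\<phi> p = - T"
proof -
  define C where "C = \<gamma> / ((b + \<rho>1 * \<gamma>) * (exp 1 - 1))"
  have C: "C > 0" using coeff_pos by (simp add: C_def)
  \<comment> \<open>Here p >= 1 gives J(p) >= J(1), and exp(k p) >= k p makes the exponential term
    of the slope at least T in size. The intermediate value theorem then finds the preimage in
    [0, p].\<close>
  define p where "p = max 1 (T / (C * k * J 1) / k)"
  have pos: "C * k * J 1 > 0" using C k_pos J_pos by simp
  have "T / (C * k * J 1) / k \<le> p" by (simp add: p_def)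
  then have "T / (C * k * J 1) \<le> k * p" using k_pos by (simp only: pos_divide_le_eq mult.commute)
  also have "\<dots> \<le> exp (k * p)" using exp_ge_add_one_self[of "k * p"] by linarith
  finally have "T \<le> C * (k * (exp (k * p) * J 1))" using pos by (simp add: field_simps)
  also have "\<dots> \<le> C * (k * (exp (k * p) * J p))"
    using C k_pos J_mono[of 1 p] by (intro mult_left_mono) (auto simp: p_def)
  also have "\<dots> \<le> C * (h (\<theta> * p) + k * (exp (k * p) * J p))"
    using C h_nonneg[of "\<theta> * p"] theta_pos by (intro mult_left_mono) (auto simp: p_def)
  finally have "\<phi> p \<le> - T" by (simp add: slope_eq p_def C_def)
  then have "\<exists>x. 0 \<le> x \<and> x \<le> p \<and> \<phi> x = - T"
    using assms slope_0 by (intro IVT2' continuous_on_subset[OF slope_continuous]) (auto simp: p_def)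
  with that show ?thesis by blast
qed

end

section \<open>Competitive ratio\<close>

lemma psd_mats_imp_sym: "A \<in> psd_mats \<Longrightarrow> A \<in> sym_mats"
  by (simp add: psd_mats_def)

lemma psd_mats_0: "0 \<in> psd_mats"
  using subspace_0[OF subspace_sym_mats] by (simp add: psd_mats_def)

lemma psd_mats_scaleR: "A \<in> psd_mats \<Longrightarrow> r \<ge> 0 \<Longrightarrow> r *\<^sub>R A \<in> psd_mats"
  using subspace_scale[OF subspace_sym_mats]
  by (auto simp: psd_mats_def scaleR_matrix_vector_assoc[symmetric])

lemma psd_mats_add: "A \<in> psd_mats \<Longrightarrow> B \<in> psd_mats \<Longrightarrow> A + B \<in> psd_mats"
  using subspace_add[OF subspace_sym_mats]
  by (auto simp: psd_mats_def matrix_vector_mult_add_rdistrib inner_add_right)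

lemma psd_mats_sum: "(\<And>i. i \<in> I \<Longrightarrow> f i \<in> psd_mats) \<Longrightarrow> sum f I \<in> psd_mats"
  by (induction I rule: infinite_finite_induct) (auto simp: psd_mats_0 psd_mats_add)

lemma psd_mats_diffD: "V - U \<in> psd_mats \<Longrightarrow> w \<bullet> (U *v w) \<le> w \<bullet> (V *v w)"
  by (simp add: psd_mats_def matrix_vector_mult_diff_rdistrib inner_diff_right)

lemma lambda_max_psd:
  fixes A :: "real^'n^'n"
  assumes "A \<in> psd_mats"
  shows "lambda_max A \<ge> 0"
  using assms eigen_system_exists[OF psd_mats_imp_sym[OF assms]]
  by (metis eigen_system_le_lambda_max eigen_system_psd_mats order_trans psd_mats_imp_sym)

lemma lambda_max_bound_psd:
  fixes A :: "real^'n^'n"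
  assumes "A \<in> sym_mats" "lambda_max A \<le> r"
  shows "r *\<^sub>R mat 1 - A \<in> psd_mats"
  unfolding psd_mats_def
proof (intro CollectI conjI allI)
  have "mat 1 \<in> (sym_mats :: (real^'n^'n) set)" by (simp add: sym_mats_def transpose_mat)
  then show "r *\<^sub>R mat 1 - A \<in> sym_mats"
    using assms(1) by (intro subspace_diff subspace_scale subspace_sym_mats)
  fix v
  have "v \<bullet> (A *v v) \<le> r * (v \<bullet> v)"
    using quadratic_le_lambda_max[OF assms(1), of v] mult_right_mono[OF assms(2), of "v \<bullet> v"] by simp
  then show "0 \<le> v \<bullet> ((r *\<^sub>R mat 1 - A) *v v)"
    by (simp add: matrix_vector_mult_diff_rdistrib scaleR_matrix_vector_assoc[symmetric] inner_diff_right)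
qed

lemma mat_inner_scaleR_mat_1: "mat_inner (r *\<^sub>R mat 1) B = r * trace B"
proof -
  have "mat_inner (r *\<^sub>R mat 1) B = r * mat_inner B (mat 1)"
    by (simp add: mat_inner_commute[of "r *\<^sub>R mat 1"] mat_inner_scaleR_right)
  then show ?thesis by (simp add: mat_inner_def)
qed

lemma trace_spectral_mat:
  assumes "orthonormal u"
  shows "trace (spectral_mat g l u) = (\<Sum>i\<in>UNIV. g (l i))"
proof -
  have "trace (spectral_mat g l u) = mat_inner (spectral_mat g l u) (mat 1)"
    by (simp add: mat_inner_def)
  then show ?thesis using assms by (simp add: mat_inner_spectral_mat orthonormal_def)
qed

lemma spectral_mat_zero:
  assumes "eigen_system 0 l u"
  shows "spectral_mat g l u = g 0 *\<^sub>R mat 1"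
proof -
  have on: "orthonormal u" using assms by (simp add: eigen_system_def)
  have "l i = 0" for i
    using assms by (simp add: eigen_system_def orthonormal_def) (metis inner_zero_left zero_neq_one)
  then have "spectral_mat g l u *v w = g 0 *\<^sub>R (\<Sum>i\<in>UNIV. (u i \<bullet> w) *\<^sub>R u i)" for w
    by (simp add: spectral_mat_apply scaleR_sum_right)
  then show ?thesis
    by (simp add: matrix_eq orthonormal_expand[OF on] scaleR_matrix_vector_assoc[symmetric])
qed

lemma h_conj_le_0: "h 0 = 0 \<Longrightarrow> h_conj h a \<le> 0"
  unfolding h_conj_def concave_conj_def by (rule INF_lower2[of 0]) auto

text \<open>The hypothesis \<open>h_conj h (y u) > -\<infinity>\<close> implicit in feasibility makes the conjugate a real number \<open>q\<close>.\<close>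

lemma surrogate_feasible_conj:
  assumes f: "surrogate_feasible h \<gamma> \<rho>2 umax \<beta> y \<mu>" and h0: "h 0 = 0" and u: "u \<in> {0..umax}"
  obtains q where "\<And>a. a \<ge> 0 \<Longrightarrow> q \<le> y u * a - h a" "q \<le> 0"
    "\<gamma> * hS y u + \<gamma> * \<rho>2 * (y 0 - y u) - q \<le> \<beta> * h u"
proof -
  have le: "ereal (\<gamma> * integral {0..u} y + \<gamma> * \<rho>2 * (y 0 - y u)) - h_conj h (y u) \<le> ereal (\<beta> * h u)"
    using f u by (simp add: surrogate_feasible_def)
  obtain q where q: "h_conj h (y u) = ereal q"
    using le h_conj_le_0[of h "y u"] h0 by (cases "h_conj h (y u)") auto
  show ?thesis
  proof (rule that)
    fix a :: real assume "a \<ge> 0"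
    then have "h_conj h (y u) \<le> ereal (y u * a - h a)"
      unfolding h_conj_def concave_conj_def by (intro INF_lower) auto
    then show "q \<le> y u * a - h a" by (simp add: q)
  next
    show "q \<le> 0" using h_conj_le_0[of h "y u"] h0 by (simp add: q)
    show "\<gamma> * hS y u + \<gamma> * \<rho>2 * (y 0 - y u) - q \<le> \<beta> * h u"
      using le u by (simp add: q hS_def)
  qed
qed

text \<open>If umax <= 0, the inequality is tested at most at u = 0, where h vanishes and beta drops
  out. Then beta - 1 is feasible too, so no real optimum exists.\<close>

lemma surrogate_value_umax_pos:
  assumes f: "surrogate_feasible h \<gamma> \<rho>2 umax \<beta> y \<mu>" and opt: "ereal \<beta> = surrogate_value h \<gamma> \<rho>2 umax"
    and h0: "h 0 = 0"
  shows "umax > 0"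
proof (rule ccontr)
  assume "\<not> umax > 0"
  then have "u = 0" if "u \<in> {0..umax}" for u using that by auto
  then have "surrogate_feasible h \<gamma> \<rho>2 umax (\<beta> - 1) y \<mu>"
    using f h0 unfolding surrogate_feasible_def by fastforce
  then have "surrogate_value h \<gamma> \<rho>2 umax \<le> ereal (\<beta> - 1)"
    unfolding surrogate_value_def by (intro Inf_lower) auto
  then show False by (simp flip: opt)
qed

lemma stieltjes_spectral_mat_diff_psd:
  fixes U V :: "real^'n^'n"
  assumes y: "stieltjes \<mu> y"
    and U: "U \<in> psd_mats" "eigen_system U l u" and V: "V \<in> psd_mats" "eigen_system V k v"
    and le: "V - U \<in> psd_mats"
  shows "spectral_mat y l u - spectral_mat y k v \<in> psd_mats"
  unfolding psd_mats_def
  using stieltjes_operator_antimono[OF y U V psd_mats_diffD[OF le]]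
  by (auto simp: matrix_vector_mult_diff_rdistrib inner_diff_right
      intro!: subspace_diff subspace_sym_mats spectral_mat_sym)

theorem theorem2:
  fixes A :: "nat \<Rightarrow> real^'n^'n" and c :: "nat \<Rightarrow> real" and m :: nat
    and b \<gamma> \<theta> \<Theta> \<rho>1 \<rho>2 umax :: real
    and h h' y :: "real \<Rightarrow> real" and x z :: "nat \<Rightarrow> real" and Y :: "nat \<Rightarrow> real^'n^'n"
  assumes m: "m \<ge> 1"
    and A_psd: "\<And>t. t \<in> {1..m} \<Longrightarrow> A t \<in> psd_mats"
    and c_pos: "\<And>t. t \<in> {1..m} \<Longrightarrow> c t > 0"
    and b_pos: "b > 0"
    and h_concave: "concave_on {0..} h"
    and h_mono: "mono_on {0..} h"
    and h_deriv: "\<And>u. u \<ge> 0 \<Longrightarrow> (h has_real_derivative h' u) (at u within {0..})"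
    and h_0: "h 0 = 0"
    and gamma: "\<gamma> \<ge> 1"
    and ratio: "\<And>t. t \<in> {1..m} \<Longrightarrow> \<theta> \<le> inverse (c t) * trace (A t) \<and> inverse (c t) * trace (A t) \<le> \<Theta>"
    and theta_pos: "\<theta> > 0"
    and h'_0: "h' 0 > 0"
    and rho1: "\<rho>1 \<ge> Max (c ` {1..m})"
    and rho2: "\<rho>2 \<ge> Max ((\<lambda>t. lambda_max (A t)) ` {1..m})"
    and y_opt: "surrogate_optimal h \<gamma> \<rho>2 umax y"
    and hS_0: "deriv (hS y) 0 = h' 0"
    and alg: "sequential_update m A c (spectral_sum (hS y)) (GS b \<theta> \<gamma> \<rho>1 h') x Y z"
    and umax: "umax \<ge> lambda_max (\<Sum>t=1..m. x t *\<^sub>R A t)"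
  shows "(\<Sum>t=1..m. c t * x t) \<le>
           the_inv_into {0..} (deriv (GS b \<theta> \<gamma> \<rho>1 h')) (- h' 0 * \<Theta>) + \<rho>1 \<and>
         ereal (spectral_sum h (\<Sum>t=1..m. x t *\<^sub>R A t)) \<ge>
           1 / (ereal (\<gamma> / (exp 1 - 1)) + surrogate_value h \<gamma> \<rho>2 umax) * dual_value m A c b h"
proof -
  let ?G = "GS b \<theta> \<gamma> \<rho>1 h'" and ?F = "spectral_sum (hS y) :: real^'n^'n \<Rightarrow> real"
  obtain \<beta> \<mu> where f: "surrogate_feasible h \<gamma> \<rho>2 umax \<beta> y \<mu>" and \<beta>: "ereal \<beta> = surrogate_value h \<gamma> \<rho>2 umax"
    using y_opt by (auto simp: surrogate_optimal_def)
  have y: "stieltjes \<mu> y" by (rule surrogate_feasible_stieltjes[OF f])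
  have y0: "y 0 = h' 0" using hS_0 deriv_hS_0[OF y] by simp
  have umax_pos: "umax > 0" by (rule surrogate_value_umax_pos[OF f \<beta> h_0])
  have c_le: "c t \<le> \<rho>1" and A_le: "lambda_max (A t) \<le> \<rho>2" if "t \<in> {1..m}" for t
    using that rho1 rho2 by auto
  have one: "1 \<in> {1..m}" using m by simp
  have rho1_pos: "\<rho>1 > 0" using c_le[OF one] c_pos[OF one] by linarith
  have rho2_nonneg: "\<rho>2 \<ge> 0" using A_le[OF one] lambda_max_psd[OF A_psd[OF one]] by linarith
  interpret budget_surrogate b \<theta> \<gamma> \<rho>1 h h'
    by unfold_locales (use b_pos theta_pos gamma rho1_pos h_mono h_deriv h_0 h'_0 in auto)

  define S where "S t = (\<Sum>s=1..t. c s * x s)" for t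
  define U where "U t = (\<Sum>s=1..t. x s *\<^sub>R A s)" for t
  have x01: "x t = 0 \<or> x t = 1" if "t \<in> {1..m}" for t
    using alg that by (auto simp: sequential_update_def)
  then have x_nonneg: "0 \<le> x t" and x_le: "x t \<le> 1" if "t \<in> {1..m}" for t using that by force+
  have x_def: "x t = (if c t * z (t - 1) + mat_inner (A t) (Y (t - 1)) > 0 then 1 else 0)"
    if "t \<in> {1..m}" for t using alg that by (auto simp: sequential_update_def)
  have cx: "0 \<le> c t * x t" if "t \<in> {1..m}" for t using c_pos x_nonneg that by (simp add: less_imp_le)
  have S_step: "S t = S (t - 1) + c t * x t" and U_step: "U t = U (t - 1) + x t *\<^sub>R A t" if "t \<in> {1..m}" for t
    using that by (cases t; simp add: S_def U_def)+
  have xA_psd: "x t *\<^sub>R A t \<in> psd_mats" if "t \<in> {1..m}" for t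
    using A_psd x_nonneg that by (simp add: psd_mats_scaleR)
  have U_psd: "U t \<in> psd_mats" if "t \<le> m" for t
    unfolding U_def by (rule psd_mats_sum) (use that xA_psd in auto)
  have U_mono: "U t - U s \<in> psd_mats" if "s \<le> t" "t \<le> m" for s t
  proof -
    have "U t - U s = (\<Sum>r\<in>{1..t} - {1..s}. x r *\<^sub>R A r)"
      unfolding U_def using that(1) by (subst sum_diff) auto
    then show ?thesis using that xA_psd by (auto intro!: psd_mats_sum)
  qed
  have S_nonneg: "S t \<ge> 0" if "t \<le> m" for t
    unfolding S_def by (rule sum_nonneg) (use that cx in auto)
  have S_mono: "S s \<le> S t" if "s \<le> t" "t \<le> m" for s t
    unfolding S_def by (rule sum_mono2) (use that cx in auto)
  have z: "z t = \<phi> (S t)" if "t \<le> m" for t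
  proof -
    have "z t = deriv ?G (S t)"
      using alg that by (cases "t = 0") (auto simp: sequential_update_def S_def)
    then show ?thesis using deriv_GS[OF S_nonneg[OF that]] by simp
  qed
  have "\<forall>t. \<exists>l u. t \<le> m \<longrightarrow> eigen_system (U t) l u"
    using eigen_system_exists psd_mats_imp_sym[OF U_psd] by metis
  then obtain l u where eU: "\<And>t. t \<le> m \<Longrightarrow> eigen_system (U t) (l t) (u t)" by metis
  have Y: "Y t = spectral_mat y (l t) (u t)" if "t \<le> m" for t
  proof -
    have "Y t = sym_gradient ?F (U t)"
      using alg that by (cases "t = 0") (auto simp: sequential_update_def U_def)
    then show ?thesis using sym_gradient_spectral_sum_hS[OF y U_psd[OF that] eU[OF that]] by simp
  qed
  have on: "orthonormal (u t)" if "t \<le> m" for t using eU[OF that] by (simp add: eigen_system_def)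
  have Y_mono: "Y s - Y t \<in> psd_mats" if "s \<le> t" "t \<le> m" for s t
    using that stieltjes_spectral_mat_diff_psd[OF y U_psd eU U_psd eU U_mono] by (simp add: Y)
  have z_mono: "z t \<le> z s" if "s \<le> t" "t \<le> m" for s t
    using that slope_antimono[of "S s" "S t"] S_nonneg[of s] S_mono[of s t] by (simp add: z)
  have AY_mono: "mat_inner (A r) (Y t) \<le> mat_inner (A r) (Y s)" if "s \<le> t" "t \<le> m" "r \<in> {1..m}" for s t r
    using mat_inner_psd_nonneg[OF A_psd[OF that(3)] Y_mono[OF that(1,2)]] by (simp add: mat_inner_diff_right)
  have Y_0: "Y 0 = y 0 *\<^sub>R mat 1"
    using Y[of 0] eU[of 0] spectral_mat_zero[of "l 0" "u 0" y] by (simp add: U_def)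
  have z_0: "z 0 = 0" using z[of 0] slope_0 by (simp add: S_def)

  have budget: "S m \<le> the_inv_into {0..} (deriv ?G) (- h' 0 * \<Theta>) + \<rho>1"
  proof -
    have "0 < \<theta>" "\<theta> \<le> \<Theta>" using theta_pos ratio[OF one] by auto
    then have "h' 0 * \<Theta> \<ge> 0" using h'_0 by simp
    then obtain p where p: "p \<ge> 0" "\<phi> p = - (h' 0 * \<Theta>)" by (rule slope_surj)
    have "inj_on (deriv ?G) {0..}"
    proof (rule linorder_inj_onI)
      fix v w :: real assume "v < w" "v \<in> {0..}" "w \<in> {0..}"
      then show "deriv ?G v \<noteq> deriv ?G w" using slope_strict_antimono[of v w] by (simp add: deriv_GS)
    qed auto
    then have inv: "the_inv_into {0..} (deriv ?G) (- h' 0 * \<Theta>) = p"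
      using p by (intro the_inv_into_f_eq) (auto simp: deriv_GS)
    \<comment> \<open>A step with x = 1 starts strictly below p and adds at most rho1; a step with x
      = 0 leaves S unchanged.\<close>
    have "S t \<le> p + \<rho>1" if "t \<le> m" for t
      using that
    proof (induction t)
      case 0
      then show ?case using p(1) rho1_pos by (simp add: S_def)
    next
      case (Suc t)
      then have t: "Suc t \<in> {1..m}" "t \<le> m" by auto
      show ?case
      proof (cases "x (Suc t) = 0")
        case True
        then show ?thesis using Suc.IH t S_step[OF t(1)] by simp
      next
        case False
        then have x1: "x (Suc t) = 1" using x01[OF t(1)] by simp
        then have "0 < c (Suc t) * z t + mat_inner (A (Suc t)) (Y t)"
          using x_def[OF t(1)] by (simp split: if_splits)
        also have "mat_inner (A (Suc t)) (Y t) \<le> mat_inner (A (Suc t)) (Y 0)"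
          using t by (intro AY_mono) auto
        also have "mat_inner (A (Suc t)) (Y 0) = h' 0 * trace (A (Suc t))"
          by (simp add: Y_0 y0 mat_inner_scaleR_right) (simp add: mat_inner_def)
        also have "\<dots> \<le> h' 0 * (c (Suc t) * \<Theta>)"
        proof (rule mult_left_mono)
          show "trace (A (Suc t)) \<le> c (Suc t) * \<Theta>"
            using ratio[OF t(1)] c_pos[OF t(1)] by (simp add: field_simps)
        qed (use h'_0 in simp)
        finally have "0 < c (Suc t) * (z t + h' 0 * \<Theta>)" by (simp add: algebra_simps)
        then have "\<phi> p < \<phi> (S t)" using c_pos[OF t(1)] p(2) z[OF t(2)] by (simp add: zero_less_mult_iff)
        then have "S t < p" using slope_antimono[OF p(1), of "S t"] by linarith
        then show ?thesis using S_step[OF t(1)] x1 c_le[OF t(1)] by simp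
      qed
    qed
    then show ?thesis using inv by simp
  qed

  have l_nonneg: "0 \<le> l m i" for i by (rule eigen_system_psd_mats[OF eU U_psd]) auto
  have l_le: "l m i \<le> umax" for i
    using eigen_system_le_lambda_max[OF psd_mats_imp_sym[OF U_psd] eU, of m i] umax by (simp add: U_def)
  have "\<exists>q. (\<forall>a\<ge>0. q \<le> y (l m i) * a - h a) \<and>
      \<gamma> * hS y (l m i) + \<gamma> * \<rho>2 * (y 0 - y (l m i)) - q \<le> \<beta> * h (l m i)" for i
    using surrogate_feasible_conj[OF f h_0, of "l m i"] l_nonneg l_le by (metis atLeastAtMost_iff)
  then obtain q where q: "\<And>i a. a \<ge> 0 \<Longrightarrow> q i \<le> y (l m i) * a - h a"
    and q_le: "\<And>i. \<gamma> * hS y (l m i) + \<gamma> * \<rho>2 * (y 0 - y (l m i)) - q i \<le> \<beta> * h (l m i)" by metis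
  have trY: "trace (Y t) = (\<Sum>i\<in>UNIV. y (l t i))" if "t \<le> m" for t
    using that by (simp add: Y trace_spectral_mat[OF on])
  have trY0: "trace (Y 0) = (\<Sum>i\<in>(UNIV :: 'n set). y 0)"
    by (simp add: Y_0 trace_def mat_def)
  have FU: "?F (U m) = (\<Sum>i\<in>UNIV. hS y (l m i))" and HU: "spectral_sum h (U m) = (\<Sum>i\<in>UNIV. h (l m i))"
    by (simp_all add: spectral_sum_eigen_system[OF psd_mats_imp_sym[OF U_psd] eU])
  have F0: "?F (U 0) = 0"
  proof -
    have "l 0 i = 0" for i
      using eU[of 0] on[of 0] by (simp add: U_def eigen_system_def orthonormal_def) (metis inner_zero_left zero_neq_one)
    then show ?thesis
      by (simp add: spectral_sum_eigen_system[OF psd_mats_imp_sym[OF U_psd] eU] hS_def)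
  qed
  have sumH: "\<gamma> * (?F (U m) + \<rho>2 * (trace (Y 0) - trace (Y m))) - (\<Sum>i\<in>UNIV. q i) \<le> \<beta> * spectral_sum h (U m)"
    using sum_mono[of UNIV, OF q_le]
    by (simp add: FU HU trY trY0 sum.distrib sum_subtractf sum_distrib_left algebra_simps)

  have stepF: "x t * mat_inner (A t) (Y (t - 1)) \<le>
      (?F (U t) - ?F (U (t - 1))) + \<rho>2 * (trace (Y (t - 1)) - trace (Y t))" if t: "t \<in> {1..m}" for t
  proof -
    have tm: "t \<le> m" "t - 1 \<le> m" using t by auto
    \<comment> \<open>The tangent is taken at the new point \<open>U t\<close> and read backwards,
      so that the gain of F bounds the pairing with \<open>Y t\<close>. Deciding with the older
      \<open>Y (t - 1)\<close> costs the pairing with \<open>Y (t - 1) - Y t\<close>, which is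
      estimated separately.\<close>
    have "?F (U (t - 1)) \<le> ?F (U t) + mat_inner (Y t) (U (t - 1) - U t)"
      unfolding Y[OF tm(1)]
      by (rule spectral_sum_klein[OF psd_mats_imp_sym[OF U_psd[OF tm(1)]] eU[OF tm(1)]
            psd_mats_imp_sym[OF U_psd[OF tm(2)]] eU[OF tm(2)]])
        (rule stieltjes_hS_tangent[OF y eigen_system_psd_mats[OF eU[OF tm(1)] U_psd[OF tm(1)]]])
    also have "U (t - 1) - U t = (- x t) *\<^sub>R A t" using U_step[OF t] by simp
    finally have 1: "x t * mat_inner (A t) (Y t) \<le> ?F (U t) - ?F (U (t - 1))"
      by (simp only: mat_inner_scaleR_right mat_inner_commute[of "Y t"])
    have D: "Y (t - 1) - Y t \<in> psd_mats" using Y_mono tm by simp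
    have "x t * mat_inner (A t) (Y (t - 1) - Y t) \<le> 1 * mat_inner (A t) (Y (t - 1) - Y t)"
      using x_le[OF t] by (intro mult_right_mono mat_inner_psd_nonneg[OF A_psd[OF t] D])
    \<comment> \<open>Pair the two positive semidefinite matrices rho2 I - A_t and Y_{t-1} -
      Y_t.\<close>
    also have "\<dots> \<le> \<rho>2 * trace (Y (t - 1) - Y t)"
      using mat_inner_psd_nonneg[OF lambda_max_bound_psd[OF psd_mats_imp_sym[OF A_psd[OF t]] A_le[OF t]] D]
      by (simp add: mat_inner_diff_left mat_inner_scaleR_mat_1)
    finally have "x t * mat_inner (A t) (Y (t - 1) - Y t) \<le> \<rho>2 * (trace (Y (t - 1)) - trace (Y t))"
      by (simp add: trace_sub)
    then show ?thesis using 1 by (simp add: mat_inner_diff_right right_diff_distrib)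
  qed
  have stepG: "x t * (c t * z (t - 1)) \<le> (?G (S t) - ?G (S (t - 1))) + \<rho>1 * (z (t - 1) - z t)"
    if t: "t \<in> {1..m}" for t
  proof -
    have tm: "t \<le> m" "t - 1 \<le> m" using t by auto
    have "?G (S (t - 1)) \<le> ?G (S t) + \<phi> (max 0 (S t)) * (S (t - 1) - S t)"
      by (rule tangent_above[OF GS_deriv]) (auto intro!: slope_antimono max.mono)
    then have "z t * (c t * x t) \<le> ?G (S t) - ?G (S (t - 1))"
      using S_step[OF t] S_nonneg[OF tm(1)] by (simp add: z[OF tm(1)] max_def)
    \<comment> \<open>The scalar counterpart of the lag error: one step spends at most rho1.\<close>
    moreover have "(c t * x t) * (z (t - 1) - z t) \<le> \<rho>1 * (z (t - 1) - z t)"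
    proof (rule mult_right_mono)
      show "c t * x t \<le> \<rho>1" using x01[OF t] c_le[OF t] rho1_pos by auto
      show "0 \<le> z (t - 1) - z t" using z_mono tm by simp
    qed
    ultimately show ?thesis by (simp add: algebra_simps)
  qed
  have tel: "(\<Sum>t=1..m. g t - g (t - 1)) = g m - g 0" for g :: "nat \<Rightarrow> real"
    using sum_telescope''[of 0 m g] by simp
  have tel': "(\<Sum>t=1..m. g (t - 1) - g t) = g 0 - g m" for g :: "nat \<Rightarrow> real"
    using tel[of "\<lambda>t. - g t"] by simp

  define R where "R = (\<Sum>t=1..m. x t * mat_inner (A t) (Y (t - 1)) + x t * (c t * z (t - 1)))"
  have R_upper: "R \<le> ?F (U m) + \<rho>2 * (trace (Y 0) - trace (Y m)) + (?G (S m) - \<rho>1 * z m)"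
  proof -
    have "R \<le> (\<Sum>t=1..m. ((?F (U t) - ?F (U (t - 1))) + \<rho>2 * (trace (Y (t - 1)) - trace (Y t)))
        + ((?G (S t) - ?G (S (t - 1))) + \<rho>1 * (z (t - 1) - z t)))"
      unfolding R_def by (intro sum_mono add_mono stepF stepG)
    also have "\<dots> = (?F (U m) - ?F (U 0)) + \<rho>2 * (trace (Y 0) - trace (Y m))
        + ((?G (S m) - ?G (S 0)) + \<rho>1 * (z 0 - z m))"
      by (simp only: sum.distrib sum_distrib_left[symmetric] tel[of "\<lambda>t. ?F (U t)"] tel[of "\<lambda>t. ?G (S t)"]
          tel'[of "\<lambda>t. trace (Y t)"] tel'[of z])
    also have "?G (S 0) = 0" by (simp add: S_def GS_def)
    finally show ?thesis by (simp add: F0 z_0)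
  qed
  have R_term: "max 0 (mat_inner (A t) (Y m) + c t * z m) \<le> x t * mat_inner (A t) (Y (t - 1)) + x t * (c t * z (t - 1))"
    if t: "t \<in> {1..m}" for t
  proof -
    have "mat_inner (A t) (Y m) \<le> mat_inner (A t) (Y (t - 1))" using t by (intro AY_mono) auto
    moreover have "c t * z m \<le> c t * z (t - 1)"
      using c_pos[OF t] t by (intro mult_left_mono z_mono) auto
    \<comment> \<open>If x_t = 0, the combined price at time t - 1 is nonpositive, hence also the
      final one, and both sides are 0.\<close>
    ultimately show ?thesis by (auto simp: x_def[OF t])
  qed
  define P where "P = (\<Sum>t=1..m. max 0 (mat_inner (A t) (Y m) + c t * z m))"
  have "P \<le> R" unfolding P_def R_def by (intro sum_mono R_term)
  moreover have "0 \<le> P" unfolding P_def by (intro sum_nonneg) auto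
  ultimately have "P \<le> \<gamma> * R" using mult_right_mono[OF gamma, of R] by simp
  also have "\<dots> \<le> \<gamma> * (?F (U m) + \<rho>2 * (trace (Y 0) - trace (Y m)) + (?G (S m) - \<rho>1 * z m))"
    using R_upper gamma by (intro mult_left_mono) auto
  \<comment> \<open>The terms in \<open>z m\<close> add up to -(b + rho1 gamma) z_m, the left-hand
    side of \<open>slope_GS\<close> with its sign changed, so the scalar part collapses to gamma/(e
    - 1) h(theta S_m).\<close>
  finally have P_le: "P - (\<Sum>i\<in>UNIV. q i) - b * z m \<le> \<beta> * spectral_sum h (U m) + \<gamma> / (exp 1 - 1) * h (\<theta> * S m)"
    using sumH slope_GS[OF S_nonneg[of m]] by (simp add: z[of m]) (simp add: algebra_simps)

  \<comment> \<open>The lower ratio bound converts spending into trace; subadditivity of h then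
    distributes the trace over the eigenvalues.\<close>
  have "h (\<theta> * S m) \<le> h (trace (U m))"
  proof (rule mono_onD[OF h_mono])
    have "\<theta> * S m \<le> (\<Sum>t=1..m. x t * trace (A t))"
      unfolding S_def sum_distrib_left
    proof (rule sum_mono)
      fix t assume t: "t \<in> {1..m}"
      have "\<theta> * c t \<le> trace (A t)" using ratio[OF t] c_pos[OF t] by (simp add: field_simps)
      from mult_right_mono[OF this x_nonneg[OF t]]
      show "\<theta> * (c t * x t) \<le> x t * trace (A t)" by (simp add: mult_ac)
    qed
    also have "\<dots> = trace (U m)"
      unfolding U_def trace_def by (simp add: sum_distrib_left sum.swap[of _ UNIV])
    finally show "\<theta> * S m \<le> trace (U m)" .
    then show "\<theta> * S m \<in> {0..}" "trace (U m) \<in> {0..}"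
      using theta_pos S_nonneg[of m] by (auto intro: order_trans[rotated])
  qed
  also have "trace (U m) = (\<Sum>i\<in>UNIV. l m i)"
    using trace_spectral_mat[OF on[of m], of "\<lambda>v. v" "l m"] by (simp add: eigen_system_spectral_mat[OF eU])
  also have "h (\<Sum>i\<in>UNIV. l m i) \<le> spectral_sum h (U m)"
    unfolding HU by (rule concave_on_sum_le[OF h_concave h_0]) (auto simp: l_nonneg)
  finally have h_le: "h (\<theta> * S m) \<le> spectral_sum h (U m)" .
  define C where "C = \<gamma> / (exp 1 - 1) + \<beta>"
  have "P - (\<Sum>i\<in>UNIV. q i) - b * z m \<le> C * spectral_sum h (U m)"
    using P_le mult_left_mono[OF h_le, of "\<gamma> / (exp 1 - 1)"] gamma
    by (simp add: C_def distrib_right)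

  \<comment> \<open>At u = umax every term on the left of the constraint is nonnegative while
    h(umax) > 0, so beta >= 0.\<close>
  have C_pos: "C > 0"
  proof -
    obtain q' where q': "q' \<le> 0" "\<gamma> * hS y umax + \<gamma> * \<rho>2 * (y 0 - y umax) - q' \<le> \<beta> * h umax"
      using surrogate_feasible_conj[OF f h_0, of umax] umax_pos by (metis atLeastAtMost_iff less_imp_le order_refl)
    have "y integrable_on {0..umax}"
      by (rule integrable_continuous_real, rule continuous_on_subset[OF stieltjes_continuous_on[OF y]]) auto
    then have "0 \<le> integral {0..umax} y"
      by (rule Henstock_Kurzweil_Integration.integral_nonneg) (rule stieltjes_nonneg[OF y], simp)
    then have "hS y umax \<ge> 0"
      using umax_pos by (simp add: hS_def)
    moreover have "y 0 - y umax \<ge> 0" using stieltjes_antimono[OF y, of 0 umax] umax_pos by simp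
    ultimately have "0 \<le> \<gamma> * hS y umax" "0 \<le> \<gamma> * \<rho>2 * (y 0 - y umax)"
      using gamma rho2_nonneg by (auto intro!: mult_nonneg_nonneg)
    then have "0 \<le> \<beta> * h umax" using q' by linarith
    then have "\<beta> \<ge> 0" using h_pos[OF umax_pos] by (simp add: zero_le_mult_iff)
    moreover have "\<gamma> / (exp 1 - 1) > 0" using gamma by simp
    ultimately show ?thesis by (simp add: C_def)
  qed
  \<comment> \<open>The sign selects the branch b z of the conjugate of the budget function.\<close>
  have zm: "z m \<le> 0" using z_mono[of 0 m] z_0 by simp
  have "dual_value m A c b h \<le> ereal P - H_conj h (Y m) - G_conj b (z m)"
    unfolding dual_value_def P_def
    using Y[of m] spectral_mat_sym[of y "l m" "u m"] by (intro INF_lower2[of "(Y m, z m)"]) auto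
  also have "\<dots> \<le> ereal P - ereal (\<Sum>i\<in>UNIV. q i) - ereal (b * z m)"
    using H_conj_spectral_mat_ge[OF on[of m], of q y "l m" h] q zm Y[of m]
    by (intro ereal_minus_mono) (auto simp: G_conj_eq[OF b_pos])
  also have "\<dots> \<le> ereal (C * spectral_sum h (U m))"
    using \<open>P - (\<Sum>i\<in>UNIV. q i) - b * z m \<le> C * spectral_sum h (U m)\<close> by simp
  finally have D: "dual_value m A c b h \<le> ereal (C * spectral_sum h (U m))" .
  have "1 / (ereal (\<gamma> / (exp 1 - 1)) + surrogate_value h \<gamma> \<rho>2 umax) = ereal (1 / C)"
    using C_pos by (simp add: \<beta>[symmetric] C_def one_ereal_def)
  moreover have "ereal (1 / C) * dual_value m A c b h \<le> ereal (1 / C) * ereal (C * spectral_sum h (U m))"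
    using C_pos by (intro ereal_mult_left_mono D) auto
  ultimately have "1 / (ereal (\<gamma> / (exp 1 - 1)) + surrogate_value h \<gamma> \<rho>2 umax) * dual_value m A c b h
      \<le> ereal (spectral_sum h (U m))"
    using C_pos by simp
  with budget show ?thesis by (simp add: S_def U_def)
qed

end
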